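(* Let $\varepsilon > 0$ be a constant. Consider the random graph process $\{G_i\}_{i=0}^{\binom{n}{2}}$ on $n$ vertices and let $\tau_1 = \min\{m : \delta(G_m)\ge 1\}$ denote the step in which the last isolated vertex disappears. Then with high probability (as $n\to\infty$) $G_{\tau_1}$ is $(1/2-\varepsilon)$-resilient with respect to connectivity.
   Context: Random graph process: $G_0$ is the empty graph on $n$ vertices; for each $i\in\{1,\dots,\binom n2\}$, $G_i$ is obtained from $G_{i-1}$ by adding an edge $e\notin E(G_{i-1})$ chosen uniformly at random among the missing edges. With high probability: with probability tending to $1$ as $n\to\infty$. $\delta(G)$ denotes the minimum degree of $G$. $\alpha$-resilience: Let $G=(V,E)$ be a graph, $\mathcal P$ a monotone increasing graph property, and $\alpha$ a real constant. $G$ is $\alpha$-resilient with respect to $\mathcal P$ if for every spanning subgraph $H\subseteq G$ satisfying $\deg_H(v)\le \alpha\deg_G(v)$ for all $v\in V$, we have $G-H\in\mathcal P$, where $G-H$ is the graph on $V$ with edge set $E(G)\setminus E(H)$. *)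

theory Defs
  imports "HOL-Probability.Probability"
begin

text \<open>Simple graphs are given by a vertex set and a set of two-element subsets of it as edges.\<close>

record 'a ugraph =
  verts :: "'a set"
  edges :: "'a set set"

definition wf_graph :: "'a ugraph \<Rightarrow> bool" where
  "wf_graph G \<longleftrightarrow> (\<forall>e\<in>edges G. e \<subseteq> verts G \<and> card e = 2)"

definition vdegree :: "'a ugraph \<Rightarrow> 'a \<Rightarrow> nat" where
  "vdegree G v = card {e \<in> edges G. v \<in> e}"

definition min_degree :: "'a ugraph \<Rightarrow> nat" where
  "min_degree G = Min (vdegree G ` verts G)"

definition connected_graph :: "'a ugraph \<Rightarrow> bool" where
  "connected_graph G \<longleftrightarrow> verts G \<noteq> {} \<and>
     (\<forall>u\<in>verts G. \<forall>v\<in>verts G. (u, v) \<in> {(x, y). {x, y} \<in> edges G}\<^sup>*)"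

definition spanning_subgraph :: "'a ugraph \<Rightarrow> 'a ugraph \<Rightarrow> bool" where
  "spanning_subgraph H G \<longleftrightarrow> wf_graph H \<and> verts H = verts G \<and> edges H \<subseteq> edges G"

definition monotone_increasing :: "('a ugraph \<Rightarrow> bool) \<Rightarrow> bool" where
  "monotone_increasing P \<longleftrightarrow>
     (\<forall>G H. wf_graph G \<and> spanning_subgraph H G \<and> P H \<longrightarrow> P G)"

lemma monotone_increasing_connected_graph: "monotone_increasing connected_graph"
proof -
  have "connected_graph G" if "spanning_subgraph H G" "connected_graph H" for G H :: "'a ugraph"
  proof -
    have sub: "edges H \<subseteq> edges G" and verts: "verts H = verts G"
      using that(1) by (simp_all add: spanning_subgraph_def)
    have "{(x, y). {x, y} \<in> edges H}\<^sup>* \<subseteq> {(x, y). {x, y} \<in> edges G}\<^sup>*"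
      by (rule rtrancl_mono) (use sub in blast)
    moreover have "verts H \<noteq> {}"
      and "(u, v) \<in> {(x, y). {x, y} \<in> edges H}\<^sup>*" if "u \<in> verts H" "v \<in> verts H" for u v
      using \<open>connected_graph H\<close> that by (simp_all add: connected_graph_def)
    ultimately show ?thesis
      unfolding connected_graph_def verts[symmetric]
      using \<open>connected_graph H\<close>[unfolded connected_graph_def] by (intro conjI ballI) (simp, rule subsetD)
  qed
  then show ?thesis
    unfolding monotone_increasing_def by blast
qed

definition remove_edges_of :: "'a ugraph \<Rightarrow> 'a ugraph \<Rightarrow> 'a ugraph" where
  "remove_edges_of G H = \<lparr>verts = verts G, edges = edges G - edges H\<rparr>"

text \<open>The notion is meant for monotone increasing \<open>P\<close>; monotonicity is not needed to state it.\<close>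

definition resilient :: "real \<Rightarrow> ('a ugraph \<Rightarrow> bool) \<Rightarrow> 'a ugraph \<Rightarrow> bool" where
  "resilient \<alpha> P G \<longleftrightarrow>
     (\<forall>H. spanning_subgraph H G \<and>
          (\<forall>v\<in>verts G. real (vdegree H v) \<le> \<alpha> * real (vdegree G v)) \<longrightarrow>
          P (remove_edges_of G H))"

definition empty_graph :: "nat \<Rightarrow> nat ugraph" where
  "empty_graph n = \<lparr>verts = {..<n}, edges = {}\<rparr>"

definition missing_edges :: "'a ugraph \<Rightarrow> 'a set set" where
  "missing_edges G = {e. e \<subseteq> verts G \<and> card e = 2} - edges G"

definition add_edge :: "'a ugraph \<Rightarrow> 'a set \<Rightarrow> 'a ugraph" where
  "add_edge G e = \<lparr>verts = verts G, edges = insert e (edges G)\<rparr>"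

text \<open>
  The law of the trajectory \<open>[G\<^sub>0, \<dots>, G\<^sub>i]\<close>. The sets handed to \<^const>\<open>pmf_of_set\<close> are nonempty as
  long as \<open>i \<le> n choose 2\<close>.
\<close>

primrec graph_process_upto :: "nat \<Rightarrow> nat \<Rightarrow> nat ugraph list pmf" where
  "graph_process_upto n 0 = return_pmf [empty_graph n]"
| "graph_process_upto n (Suc i) =
     bind_pmf (graph_process_upto n i) (\<lambda>Gs.
       map_pmf (\<lambda>e. Gs @ [add_edge (last Gs) e]) (pmf_of_set (missing_edges (last Gs))))"

definition random_graph_process :: "nat \<Rightarrow> nat ugraph list pmf" where
  "random_graph_process n = graph_process_upto n (n choose 2)"

text \<open>For \<open>n \<ge> 2\<close> the last graph of the process is complete, so the minimum below is attained.\<close>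

definition tau1 :: "'a ugraph list \<Rightarrow> nat" where
  "tau1 Gs = (LEAST m. m < length Gs \<and> min_degree (Gs ! m) \<ge> 1)"

end

theory Submission
  imports Defs "HOL-Real_Asymp.Real_Asymp"
begin

text \<open>
  If \<open>G - H\<close> is disconnected, let \<open>S\<close> be the smaller side of a cut without edges of \<open>G - H\<close>. Summing
  the degree conditions over \<open>S\<close> gives \<open>(1 - \<alpha>) e(S, V - S) \<le> 2 \<alpha> e(S)\<close>, and since every vertex
  of \<open>S\<close> keeps a neighbour in \<open>S\<close>, also \<open>|S| \<le> 2 e(S)\<close>. Let \<open>m1\<close> and \<open>m2\<close> be about
  \<open>0.4 n ln n\<close> and \<open>n ln n\<close>; with high probability the hitting time lies between them
  (second and first moment of the number of isolated vertices). For \<open>|S| \<le> n / 3000\<close>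
  a violating cut at any time in between has \<open>e(S, V - S) \<le> 2 e(S)\<close> with the left side counted
  at time \<open>m1\<close> and the right side at time \<open>m2\<close>, so no union over the time is needed; the
  condition \<open>|S| \<le> 2 e(S)\<close> gains a factor of about \<open>1 / sqrt n\<close> for each vertex of \<open>S\<close>, the missing crossing
  edges gain more than another \<open>1 / sqrt n\<close>, and together this beats the number of sets \<open>S\<close>.
  For larger \<open>S\<close> a violation at a fixed time has probability \<open>exp (- c n ln n)\<close>, and a union over
  all \<open>S\<close> and all times suffices. All tail bounds are exponential moments of weighted edge counts; without
  independence these are controlled by Maclaurin's inequality.
\<close>

section \<open>Sampling without replacement\<close>

text \<open>The order of the draws is kept because the process at time \<open>m\<close> is the
  prefix of length \<open>m\<close>. Past exhaustion \<open>pmf_of_set\<close> would meet the empty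
  set, hence the bounds by \<open>card R\<close> below.\<close>

primrec draws :: "nat \<Rightarrow> 'a set \<Rightarrow> 'a list pmf" where
  "draws 0 R = return_pmf []"
| "draws (Suc m) R = bind_pmf (pmf_of_set R) (\<lambda>e. map_pmf ((#) e) (draws m (R - {e})))"

lemma length_draws: "es \<in> set_pmf (draws m R) \<Longrightarrow> length es = m"
  by (induction m arbitrary: es R) auto

lemma draws_distinct_subset:
  assumes "finite R" "m \<le> card R" "es \<in> set_pmf (draws m R)"
  shows "distinct es \<and> set es \<subseteq> R"
  using assms
proof (induction m arbitrary: es R)
  case (Suc m)
  then have "R \<noteq> {}" by auto
  with Suc.prems obtain e fs where es: "es = e # fs" "e \<in> R" "fs \<in> set_pmf (draws m (R - {e}))"
    by auto
  with Suc.prems have "distinct fs \<and> set fs \<subseteq> R - {e}"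
    by (intro Suc.IH) auto
  with es show ?case by auto
qed auto

lemma finite_set_pmf_draws:
  assumes "finite R" "m \<le> card R"
  shows "finite (set_pmf (draws m R))"
proof (rule finite_subset)
  show "set_pmf (draws m R) \<subseteq> {es. set es \<subseteq> R \<and> length es = m}"
    using draws_distinct_subset[OF assms] length_draws by fast
  show "finite {es. set es \<subseteq> R \<and> length es = m}"
    using assms(1) by (rule finite_lists_length_eq)
qed

text \<open>Conditioning on the first \<open>a\<close> draws. It serves to pass to prefixes, to
  estimate a second stage after a first one, and to add one edge at the end as the process
  does.\<close>

lemma draws_append:
  "draws (a + b) R = bind_pmf (draws a R) (\<lambda>xs. map_pmf ((@) xs) (draws b (R - set xs)))"
proof (induction a arbitrary: R)
  case 0
  have "(@) [] = (\<lambda>ys :: 'a list. ys)" by auto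
  then show ?case by (simp only: draws.simps bind_return_pmf set_simps Diff_empty pmf.map_ident add_0)
next
  case (Suc a)
  have "(@) (e # xs) = (\<lambda>ys. e # xs @ ys)" for e :: 'a and xs by auto
  then show ?case
    by (simp add: Suc bind_assoc_pmf map_bind_pmf bind_map_pmf pmf.map_comp o_def flip: Diff_insert2)
qed

lemma map_take_draws: "map_pmf (take a) (draws (a + b) R) = draws a R"
proof -
  have "map_pmf (take a) (draws (a + b) R) = bind_pmf (draws a R) return_pmf"
    unfolding draws_append map_bind_pmf pmf.map_comp
    by (intro bind_pmf_cong refl) (simp add: o_def length_draws)
  then show ?thesis by (simp add: bind_return_pmf')
qed

text \<open>Events at different times can thus live on one space of draws and still be estimated at
  their own time.\<close>

lemma prob_take_draws:
  assumes "a \<le> m"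
  shows "measure_pmf.prob (draws m R) {es. Q (take a es)} = measure_pmf.prob (draws a R) {es. Q es}"
proof -
  have "draws a R = map_pmf (take a) (draws m R)"
    using map_take_draws[of a "m - a" R] assms by simp
  then show ?thesis by simp
qed

section \<open>Exponential moments without independence\<close>

lemma expectation_draws_Suc:
  fixes f :: "'a list \<Rightarrow> real"
  assumes "finite R" "Suc m \<le> card R"
  shows "measure_pmf.expectation (draws (Suc m) R) f =
    (\<Sum>e\<in>R. measure_pmf.expectation (draws m (R - {e})) (\<lambda>es. f (e # es))) / card R"
proof -
  have "R \<noteq> {}" using assms by auto
  moreover have "finite (set_pmf (map_pmf ((#) e) (draws m (R - {e}))))" if "e \<in> R" for e
    using assms that by (auto intro!: finite_set_pmf_draws)
  ultimately show ?thesis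
    using assms(1)
    by (simp add: pmf_expectation_bind_pmf_of_set divide_inverse_commute flip: sum_distrib_left)
qed

text \<open>
  The right-hand side is the tangent line at \<open>T = \<mu>\<close>. It is what makes the induction step of
  Maclaurin's inequality below work: \<open>T\<close> is the mean weight after the first draw, whose average is \<open>\<mu>\<close>.
\<close>

lemma tangent_line_bound:
  fixes T \<mu> :: real
  assumes "T \<ge> 0" "\<mu> \<ge> 0" "m + 1 \<le> N"
  shows "(N * \<mu> - (real N - 1) * T) * T ^ m \<le> \<mu> ^ (m + 1) + (real m + 1 - N) * (T - \<mu>) * \<mu> ^ m"
  using assms(3)
proof (induction m)
  case 0
  then show ?case by (simp add: algebra_simps)
next
  case (Suc m)
  have "(N * \<mu> - (real N - 1) * T) * T ^ Suc m = ((N * \<mu> - (real N - 1) * T) * T ^ m) * T"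
    by simp
  also have "\<dots> \<le> (\<mu> ^ (m + 1) + (real m + 1 - N) * (T - \<mu>) * \<mu> ^ m) * T"
    using Suc assms(1) by (intro mult_right_mono) auto
  \<comment> \<open>The remainder split off here is a nonnegative multiple of
    \<open>(T - \<mu>)\<^sup>2\<close>, because \<open>m + 1\<close> is at most
    \<open>N\<close>.\<close>
  also have "\<dots> = \<mu> ^ (Suc m + 1) + (real (Suc m) + 1 - N) * (T - \<mu>) * \<mu> ^ Suc m
      - (N - real (m + 1)) * ((T - \<mu>)\<^sup>2 * \<mu> ^ m)"
    by (simp add: algebra_simps power2_eq_square)
  also have "\<dots> \<le> \<mu> ^ (Suc m + 1) + (real (Suc m) + 1 - N) * (T - \<mu>) * \<mu> ^ Suc m"
    using Suc.prems assms(2) by simp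
  finally show ?case .
qed

text \<open>
  Maclaurin's inequality: the left-hand side is the normalised elementary symmetric polynomial of degree \<open>m\<close>.
\<close>

lemma expectation_prod_draws_le:
  fixes w :: "'a \<Rightarrow> real"
  assumes "finite R" "m \<le> card R" "\<And>e. e \<in> R \<Longrightarrow> w e \<ge> 0"
  shows "measure_pmf.expectation (draws m R) (\<lambda>es. prod_list (map w es)) \<le> (sum w R / card R) ^ m"
  using assms
proof (induction m arbitrary: R)
  case 0
  then show ?case by simp
next
  case (Suc m)
  define N where "N = card R"
  define \<mu> where "\<mu> = sum w R / N"
  define T where "T e = (sum w R - w e) / (real N - 1)" for e
  have N: "m + 1 \<le> N" using Suc.prems by (simp add: N_def)
  have \<mu>: "\<mu> \<ge> 0" unfolding \<mu>_def using Suc.prems by (simp add: sum_nonneg)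
  have W: "sum w R = N * \<mu>" using N by (simp add: \<mu>_def)
  have rest: "sum w (R - {e}) = sum w R - w e" if "e \<in> R" for e
    using that Suc.prems by (simp add: sum_diff1)
  have T0: "T e \<ge> 0" if "e \<in> R" for e
  proof -
    have "sum w (R - {e}) \<ge> 0" using Suc.prems by (intro sum_nonneg) auto
    with N that show ?thesis unfolding T_def by (simp flip: rest)
  qed
  have T1: "(real N - 1) * T e = sum w R - w e" if "e \<in> R" for e
  proof (cases "N = 1")
    case True
    then have "R = {e}" using that by (auto simp: N_def card_1_singleton_iff)
    with True show ?thesis by simp
  qed (use N in \<open>simp add: T_def\<close>)
  \<comment> \<open>For \<open>N = 1\<close> the quotient \<open>T\<close> divides by zero and need
    not average to \<mu>, but then \<open>m = 0\<close> and the coefficient vanishes.\<close>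
  have sumT: "(real m + 1 - N) * (\<Sum>e\<in>R. T e - \<mu>) = 0"
  proof (cases "N = 1")
    case True
    with N show ?thesis by simp
  next
    case False
    have "(real N - 1) * (\<Sum>e\<in>R. T e - \<mu>) = (\<Sum>e\<in>R. (sum w R - w e) - (real N - 1) * \<mu>)"
      unfolding sum_distrib_left by (intro sum.cong refl) (simp add: right_diff_distrib T1)
    also have "\<dots> = 0"
      by (simp add: sum_subtractf flip: N_def) (simp add: W algebra_simps)
    finally show ?thesis using False N by simp
  qed
  have "measure_pmf.expectation (draws (Suc m) R) (\<lambda>es. prod_list (map w es))
      = (\<Sum>e\<in>R. w e * measure_pmf.expectation (draws m (R - {e})) (\<lambda>es. prod_list (map w es))) / N"
    using Suc.prems by (simp add: expectation_draws_Suc N_def del: draws.simps)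
  also have "\<dots> \<le> (\<Sum>e\<in>R. w e * T e ^ m) / N"
  proof (intro divide_right_mono sum_mono mult_left_mono)
    fix e assume e: "e \<in> R"
    have "measure_pmf.expectation (draws m (R - {e})) (\<lambda>es. prod_list (map w es))
        \<le> (sum w (R - {e}) / card (R - {e})) ^ m"
      using Suc.prems e by (intro Suc.IH) auto
    also have "real (card (R - {e})) = real N - 1"
      using e Suc.prems N by (simp add: N_def of_nat_diff)
    finally show "measure_pmf.expectation (draws m (R - {e})) (\<lambda>es. prod_list (map w es)) \<le> T e ^ m"
      using e by (simp add: T_def rest)
  qed (use Suc.prems in auto)
  also have "(\<Sum>e\<in>R. w e * T e ^ m) = (\<Sum>e\<in>R. (N * \<mu> - (real N - 1) * T e) * T e ^ m)"
    by (intro sum.cong refl) (simp add: T1 W)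
  also have "\<dots> / N \<le> (\<Sum>e\<in>R. \<mu> ^ (m + 1) + (real m + 1 - N) * (T e - \<mu>) * \<mu> ^ m) / N"
    by (intro divide_right_mono sum_mono tangent_line_bound) (use T0 \<mu> N in auto)
  also have "(\<Sum>e\<in>R. \<mu> ^ (m + 1) + (real m + 1 - N) * (T e - \<mu>) * \<mu> ^ m)
      = N * \<mu> ^ (m + 1) + ((real m + 1 - N) * (\<Sum>e\<in>R. T e - \<mu>)) * \<mu> ^ m"
    by (simp add: sum.distrib N_def sum_distrib_left sum_distrib_right)
  also have "\<dots> / N = \<mu> ^ Suc m" using N by (simp only: sumT) simp
  finally show ?case by (simp only: \<mu>_def N_def)
qed

text \<open>The estimate \<open>1 + x \<le> exp x\<close> brings Maclaurin's bound into the form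
  that independent inclusion with probability \<open>m / card R\<close> would give. Only elements of
  weight other than \<open>1\<close> contribute to the exponent.\<close>

lemma expectation_prod_draws_le_exp:
  fixes w :: "'a \<Rightarrow> real"
  assumes "finite R" "m \<le> card R" "\<And>e. e \<in> R \<Longrightarrow> w e \<ge> 0"
  shows "measure_pmf.expectation (draws m R) (\<lambda>es. prod_list (map w es))
    \<le> exp (m / card R * (\<Sum>e\<in>R. w e - 1))"
proof (cases "m = 0")
  case False
  then have R: "card R > 0" using assms by simp
  have "measure_pmf.expectation (draws m R) (\<lambda>es. prod_list (map w es)) \<le> (sum w R / card R) ^ m"
    by (rule expectation_prod_draws_le) fact+
  also have "sum w R / card R = 1 + (\<Sum>e\<in>R. w e - 1) / card R"
    using R by (simp add: sum_subtractf field_simps)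
  also have "(1 + (\<Sum>e\<in>R. w e - 1) / card R) ^ m \<le> exp ((\<Sum>e\<in>R. w e - 1) / card R) ^ m"
  proof (rule power_mono)
    have "1 + (\<Sum>e\<in>R. w e - 1) / card R = sum w R / card R"
      using R by (simp add: sum_subtractf field_simps)
    also have "\<dots> \<ge> 0" using assms by (simp add: sum_nonneg)
    finally show "0 \<le> 1 + (\<Sum>e\<in>R. w e - 1) / card R" .
  qed simp
  also have "\<dots> = exp (m / card R * (\<Sum>e\<in>R. w e - 1))"
    by (simp flip: exp_of_nat_mult)
  finally show ?thesis .
qed simp

lemma expectation_mono_pmf:
  fixes f g :: "'a \<Rightarrow> real"
  assumes "finite (set_pmf p)" "\<And>x. x \<in> set_pmf p \<Longrightarrow> f x \<le> g x"
  shows "measure_pmf.expectation p f \<le> measure_pmf.expectation p g"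
  using assms by (intro integral_mono_AE) (auto simp: AE_measure_pmf_iff intro: integrable_measure_pmf_finite)

text \<open>
  Conditioning on the first \<open>a\<close> draws, the edges they remove only decrease the second exponent,
  because \<open>w' \<ge> 1\<close>.
\<close>

lemma expectation_two_stage_draws_le:
  fixes w w' :: "'a \<Rightarrow> real"
  assumes "finite R" "a + b \<le> card R" "\<And>e. e \<in> R \<Longrightarrow> w e \<ge> 0" "\<And>e. e \<in> R \<Longrightarrow> w' e \<ge> 1"
  shows "measure_pmf.expectation (draws (a + b) R)
      (\<lambda>es. prod_list (map w (take a es)) * prod_list (map w' (drop a es)))
    \<le> exp (a / card R * (\<Sum>e\<in>R. w e - 1) + b / (real (card R) - real a) * (\<Sum>e\<in>R. w' e - 1))"
proof -
  let ?E = "measure_pmf.expectation"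
  let ?c = "exp (b / (real (card R) - real a) * (\<Sum>e\<in>R. w' e - 1))"
  have fin: "finite (set_pmf (draws a R))"
    using assms by (intro finite_set_pmf_draws) auto
  have sub: "set xs \<subseteq> R" "distinct xs" "length xs = a" if "xs \<in> set_pmf (draws a R)" for xs
    using draws_distinct_subset[of R a xs] length_draws[of xs a R] that assms by auto
  have card: "card (R - set xs) = card R - a" if "xs \<in> set_pmf (draws a R)" for xs
    using sub[OF that] by (simp add: card_Diff_subset distinct_card)
  have fin': "finite (set_pmf (draws b (R - set xs)))" if "xs \<in> set_pmf (draws a R)" for xs
    using assms card[OF that] by (intro finite_set_pmf_draws) auto
  have "?E (draws (a + b) R) (\<lambda>es. prod_list (map w (take a es)) * prod_list (map w' (drop a es)))
     = (\<Sum>xs\<in>set_pmf (draws a R). pmf (draws a R) xs *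
         ?E (draws b (R - set xs)) (\<lambda>ys. prod_list (map w xs) * prod_list (map w' ys)))"
    unfolding draws_append using fin fin' 
    by (subst pmf_expectation_bind[where A = "set_pmf (draws a R)"])
       (auto intro!: sum.cong simp: length_draws)
  also have "\<dots> = ?E (draws a R) (\<lambda>xs. prod_list (map w xs) * ?E (draws b (R - set xs)) (\<lambda>ys. prod_list (map w' ys)))"
    using fin by (simp add: integral_measure_pmf_real[where A = "set_pmf (draws a R)"] mult_ac)
  also have "\<dots> \<le> ?E (draws a R) (\<lambda>xs. prod_list (map w xs) * ?c)"
  proof (intro expectation_mono_pmf fin mult_left_mono)
    fix xs assume xs: "xs \<in> set_pmf (draws a R)"
    have "?E (draws b (R - set xs)) (\<lambda>ys. prod_list (map w' ys))
        \<le> exp (b / card (R - set xs) * (\<Sum>e\<in>R - set xs. w' e - 1))"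
      using assms card[OF xs] by (intro expectation_prod_draws_le_exp) (auto intro: order_trans[of 0 1])
    also have "\<dots> \<le> exp (b / card (R - set xs) * (\<Sum>e\<in>R. w' e - 1))"
      using assms by (intro iffD2[OF exp_le_cancel_iff] mult_left_mono sum_mono2) auto
    also have "real (card (R - set xs)) = real (card R) - a"
      using card[OF xs] assms by (simp add: of_nat_diff)
    finally show "?E (draws b (R - set xs)) (\<lambda>ys. prod_list (map w' ys)) \<le> ?c" .
    show "0 \<le> prod_list (map w xs)"
      using sub[OF xs] assms by (intro prod_list_nonneg) auto
  qed
  also have "\<dots> = ?E (draws a R) (\<lambda>xs. prod_list (map w xs)) * ?c"
    by simp
  also have "\<dots> \<le> exp (a / card R * (\<Sum>e\<in>R. w e - 1)) * ?c"
    using assms by (intro mult_right_mono expectation_prod_draws_le_exp) auto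
  finally show ?thesis by (simp add: exp_add)
qed

text \<open>Factor \<open>i\<close> is the chance that the next draw misses \<open>A\<close> after
  \<open>i\<close> draws did. The second moment needs the exact value: from below for one star, from
  above for two. If \<open>A\<close> cannot be avoided, some factor is zero, so the real subtraction
  is harmless.\<close>

lemma prob_draws_avoid:
  assumes "finite R" "A \<subseteq> R" "m \<le> card R"
  shows "measure_pmf.prob (draws m R) {es. set es \<inter> A = {}} =
    (\<Prod>i<m. (real (card R) - card A - real i) / (real (card R) - real i))"
  using assms
proof (induction m arbitrary: R)
  case 0
  then show ?case by simp
next
  case (Suc m)
  let ?f = "\<lambda>es. indicator {es. set es \<inter> A = {}} es :: real"
  define N where "N = card R"
  define Q where "Q = (\<Prod>i<m. (real N - 1 - card A - real i) / (real N - 1 - real i))"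
  have E: "measure_pmf.expectation (draws m (R - {e})) (\<lambda>es. ?f (e # es)) = (if e \<in> A then 0 else Q)"
    if e: "e \<in> R" for e
  proof (cases "e \<in> A")
    case False
    then have "measure_pmf.expectation (draws m (R - {e})) (\<lambda>es. ?f (e # es)) =
        measure_pmf.expectation (draws m (R - {e})) ?f"
      by (intro Bochner_Integration.integral_cong refl) (auto simp: indicator_def)
    also have "\<dots> = measure_pmf.prob (draws m (R - {e})) {es. set es \<inter> A = {}}"
      by simp
    also have "\<dots> = (\<Prod>i<m. (real (card (R - {e})) - card A - real i) / (real (card (R - {e})) - real i))"
      using Suc.prems e False by (intro Suc.IH) auto
    also have "real (card (R - {e})) = real N - 1"
      using e Suc.prems by (simp add: N_def of_nat_diff)
    finally show ?thesis using False by (simp add: Q_def)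
  qed (simp add: indicator_def)
  have cA: "card A \<le> N" using Suc.prems by (simp add: card_mono N_def)
  have "measure_pmf.prob (draws (Suc m) R) {es. set es \<inter> A = {}} =
      measure_pmf.expectation (draws (Suc m) R) ?f"
    by simp
  also have "\<dots> = (\<Sum>e\<in>R. if e \<in> A then 0 else Q) / N"
    using Suc.prems by (subst expectation_draws_Suc) (auto simp: E N_def intro!: sum.cong)
  also have "(\<Sum>e\<in>R. if e \<in> A then 0 else Q) = (\<Sum>e\<in>R - A. Q)"
    using Suc.prems by (intro sum.mono_neutral_cong_right) auto
  also have "\<dots> / N = (real N - card A) / N * Q"
    using Suc.prems cA by (simp add: card_Diff_subset finite_subset[of A R] N_def of_nat_diff)
  also have "\<dots> = (\<Prod>i<Suc m. (real N - card A - real i) / (real N - real i))"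
    unfolding Q_def by (simp add: prod.lessThan_Suc_shift algebra_simps del: prod.lessThan_Suc)
  finally show ?case by (simp only: N_def)
qed

lemma prod_list_two_weights:
  assumes "distinct es" "A \<inter> B = {}"
  shows "prod_list (map (\<lambda>e. if e \<in> A then u else if e \<in> B then v else 1) es) =
    (u :: real) ^ card (set es \<inter> A) * v ^ card (set es \<inter> B)"
  using assms by (induction es) auto

section \<open>Cuts, and the process as a sequence of draws\<close>

definition all_edges :: "'a set \<Rightarrow> 'a set set" where
  "all_edges S = {e. e \<subseteq> S \<and> card e = 2}"

definition crossing :: "'a set \<Rightarrow> 'a set \<Rightarrow> 'a set set" where
  "crossing V S = {e \<in> all_edges V. e \<inter> S \<noteq> {} \<and> \<not> e \<subseteq> S}"

lemma finite_all_edges: "finite S \<Longrightarrow> finite (all_edges S)"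
  by (rule finite_subset[of _ "Pow S"]) (auto simp: all_edges_def)

lemma card_all_edges: "finite S \<Longrightarrow> card (all_edges S) = card S choose 2"
  unfolding all_edges_def by (rule n_subsets)

lemma all_edges_mono: "S \<subseteq> V \<Longrightarrow> all_edges S \<subseteq> all_edges V"
  by (auto simp: all_edges_def)

lemma crossing_subset: "crossing V S \<subseteq> all_edges V"
  by (auto simp: crossing_def)

lemma all_edges_crossing_disjoint: "all_edges S \<inter> crossing V S = {}"
  by (auto simp: all_edges_def crossing_def)

lemma crossing_compl: "S \<subseteq> V \<Longrightarrow> crossing V (V - S) = crossing V S"
  by (auto simp: crossing_def all_edges_def)

lemma crossingE:
  assumes "e \<in> crossing V S"
  obtains u v where "u \<in> S" "v \<in> V - S" "e = {u, v}"
  using assms unfolding crossing_def all_edges_def card_2_iff by auto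

lemma bij_betw_crossing:
  assumes "S \<subseteq> V"
  shows "bij_betw (\<lambda>(u, v). {u, v}) (S \<times> (V - S)) (crossing V S)"
proof (rule bij_betwI')
  fix p q assume "p \<in> S \<times> (V - S)" "q \<in> S \<times> (V - S)"
  then show "((case p of (u, v) \<Rightarrow> {u, v}) = (case q of (u, v) \<Rightarrow> {u, v})) = (p = q)"
    by (auto simp: doubleton_eq_iff)
next
  fix p assume "p \<in> S \<times> (V - S)"
  then show "(case p of (u, v) \<Rightarrow> {u, v}) \<in> crossing V S"
    using assms by (auto simp: crossing_def all_edges_def card_2_iff)
next
  fix e assume "e \<in> crossing V S"
  then show "\<exists>p\<in>S \<times> (V - S). e = (case p of (u, v) \<Rightarrow> {u, v})"
    by (rule crossingE) auto
qed

lemma card_crossing: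
  assumes "S \<subseteq> V" "finite V"
  shows "card (crossing V S) = card S * (card V - card S)"
  using bij_betw_same_card[OF bij_betw_crossing[OF assms(1)]] assms
  by (simp add: card_cartesian_product card_Diff_subset finite_subset)

lemma card_crossing_vertex:
  assumes "S \<subseteq> V" "e \<in> crossing V S"
  shows "card {v \<in> S. v \<in> e} = 1"
proof -
  obtain u v where "u \<in> S" "v \<in> V - S" "e = {u, v}"
    using assms(2) by (rule crossingE)
  with assms(1) have "{w \<in> S. w \<in> e} = {u}" by auto
  then show ?thesis by simp
qed

section \<open>Double counting, and the cut left by a disconnecting deletion\<close>

lemma sum_card_incident:
  assumes "finite S" "finite E"
  shows "(\<Sum>v\<in>S. card {e \<in> E. v \<in> e}) = (\<Sum>e\<in>E. card {v \<in> S. v \<in> e})"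
proof -
  have "(\<Sum>v\<in>S. card {e \<in> E. v \<in> e}) = (\<Sum>v\<in>S. \<Sum>e\<in>E. if v \<in> e then 1 else 0)"
    using assms by (intro sum.cong refl) (simp add: sum.If_cases Int_def)
  also have "\<dots> = (\<Sum>e\<in>E. \<Sum>v\<in>S. if v \<in> e then 1 else 0)"
    by (rule sum.swap)
  also have "\<dots> = (\<Sum>e\<in>E. card {v \<in> S. v \<in> e})"
    using assms by (intro sum.cong refl) (simp add: sum.If_cases Int_def)
  finally show ?thesis .
qed

text \<open>Take the vertices reachable from some \<open>u\<close> that fails to reach some
  \<open>v\<close>; no surviving edge leaves this set. It and its complement have the same crossing
  edges, so one with at most half of the vertices can be chosen.\<close>

lemma disconnected_cut:
  assumes V: "finite V" "V \<noteq> {}"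
    and disc: "\<not> connected_graph \<lparr>verts = V, edges = E - F\<rparr>"
  obtains S where "S \<subseteq> V" "S \<noteq> {}" "2 * card S \<le> card V" "E \<inter> crossing V S \<subseteq> F"
proof -
  let ?r = "{(x, y). {x, y} \<in> E - F}\<^sup>*"
  from disc V obtain u v where uv: "u \<in> V" "v \<in> V" "(u, v) \<notin> ?r"
    by (auto simp: connected_graph_def)
  define C where "C = {x \<in> V. (u, x) \<in> ?r}"
  have CV: "C \<subseteq> V" "C \<noteq> {}" "V - C \<noteq> {}" using uv by (auto simp: C_def)
  have sub: "E \<inter> crossing V C \<subseteq> F"
  proof
    fix e assume e: "e \<in> E \<inter> crossing V C"
    then obtain x y where xy: "x \<in> C" "y \<in> V - C" "e = {x, y}"
      by (blast elim: crossingE)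
    show "e \<in> F"
    proof (rule ccontr)
      assume "e \<notin> F"
      then have "(x, y) \<in> {(x, y). {x, y} \<in> E - F}" using e xy by simp
      then have "(u, y) \<in> ?r" using xy by (auto simp: C_def intro: rtrancl_into_rtrancl)
      then show False using xy by (auto simp: C_def)
    qed
  qed
  show thesis
  proof (cases "2 * card C \<le> card V")
    case True
    then show ?thesis using CV sub that by blast
  next
    case False
    have "card (V - C) = card V - card C"
      using CV V by (simp add: card_Diff_subset finite_subset)
    with False have "2 * card (V - C) \<le> card V" by simp
    then show ?thesis using CV sub that[of "V - C"] crossing_compl[OF CV(1)] by auto
  qed
qed

text \<open>Every crossing edge at a vertex of \<open>S\<close> lies in \<open>F\<close>, so
  crossing edges are at most a share \<alpha> of each degree in \<open>S\<close>. Summing over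
  \<open>S\<close> counts inner edges twice and crossing edges once.\<close>

lemma cut_of_heavy_deletion:
  fixes \<alpha> :: real
  assumes V: "finite V" and S: "S \<subseteq> V" "E \<inter> crossing V S \<subseteq> F" and EF: "E \<subseteq> all_edges V" "F \<subseteq> E"
    and deg: "\<And>v. v \<in> V \<Longrightarrow> card {e \<in> F. v \<in> e} \<le> \<alpha> * card {e \<in> E. v \<in> e}"
    and pos: "\<And>v. v \<in> V \<Longrightarrow> card {e \<in> E. v \<in> e} \<ge> 1" and \<alpha>: "\<alpha> < 1 / 2"
  shows "card S \<le> 2 * card (E \<inter> all_edges S)"
    and "(1 - \<alpha>) * card (E \<inter> crossing V S) \<le> 2 * \<alpha> * card (E \<inter> all_edges S)"
proof -
  let ?A = "E \<inter> all_edges S" and ?B = "E \<inter> crossing V S"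
  have fin: "finite E" "finite S" "finite F"
    using V S(1) EF finite_all_edges[OF V] by (meson finite_subset)+
  have split: "card {e \<in> E. v \<in> e} = card {e \<in> ?A. v \<in> e} + card {e \<in> ?B. v \<in> e}" if "v \<in> S" for v
  proof -
    have "{e \<in> E. v \<in> e} = {e \<in> ?A. v \<in> e} \<union> {e \<in> ?B. v \<in> e}"
      using that EF by (auto simp: all_edges_def crossing_def)
    moreover have "{e \<in> ?A. v \<in> e} \<inter> {e \<in> ?B. v \<in> e} = {}"
      using all_edges_crossing_disjoint[of S V] by auto
    ultimately show ?thesis using fin by (simp add: card_Un_disjoint)
  qed
  have cross: "card {e \<in> ?B. v \<in> e} \<le> \<alpha> * (card {e \<in> ?A. v \<in> e} + card {e \<in> ?B. v \<in> e})" if "v \<in> S" for v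
  proof -
    have "card {e \<in> ?B. v \<in> e} \<le> card {e \<in> F. v \<in> e}"
      using S fin by (intro card_mono) auto
    then show ?thesis using deg[of v] split[OF that] that S by auto
  qed
  have sumA: "(\<Sum>v\<in>S. card {e \<in> ?A. v \<in> e}) = 2 * card ?A"
  proof -
    have "(\<Sum>v\<in>S. card {e \<in> ?A. v \<in> e}) = (\<Sum>e\<in>?A. card {v \<in> S. v \<in> e})"
      using fin by (intro sum_card_incident) auto
    also have "\<dots> = (\<Sum>e\<in>?A. 2)"
    proof (intro sum.cong refl)
      fix e assume "e \<in> ?A"
      then have "{v \<in> S. v \<in> e} = e" "card e = 2" by (auto simp: all_edges_def)
      then show "card {v \<in> S. v \<in> e} = 2" by simp
    qed
    finally show ?thesis by simp
  qed
  have sumB: "(\<Sum>v\<in>S. card {e \<in> ?B. v \<in> e}) = card ?B"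
    using fin S by (subst sum_card_incident) (auto simp: card_crossing_vertex)
  \<comment> \<open>A vertex of \<open>S\<close> without inner edges would have all its edges in
    \<open>F\<close>, at least one by \<open>pos\<close>: a share of \<open>1\<close>, which exceeds
    \<alpha>.\<close>
  have "(\<Sum>v\<in>S. 1) \<le> (\<Sum>v\<in>S. card {e \<in> ?A. v \<in> e})"
  proof (rule sum_mono, rule ccontr)
    fix v assume v: "v \<in> S" "\<not> 1 \<le> card {e \<in> ?A. v \<in> e}"
    then have c0: "card {e \<in> ?A. v \<in> e} = 0" by linarith
    have "(1 - \<alpha>) * card {e \<in> ?B. v \<in> e} \<le> 0"
      using cross[OF v(1)] unfolding c0 by (simp add: algebra_simps)
    moreover have "card {e \<in> ?B. v \<in> e} \<ge> 1"
      using split[OF v(1)] pos[of v] v S by auto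
    ultimately show False using \<alpha> by (simp add: mult_le_0_iff)
  qed
  then show "card S \<le> 2 * card ?A" using sumA by simp
  have "real (\<Sum>v\<in>S. card {e \<in> ?B. v \<in> e})
      \<le> \<alpha> * (real (\<Sum>v\<in>S. card {e \<in> ?A. v \<in> e}) + real (\<Sum>v\<in>S. card {e \<in> ?B. v \<in> e}))"
    unfolding of_nat_sum sum.distrib[symmetric] sum_distrib_left
    using cross by (intro sum_mono) auto
  then show "(1 - \<alpha>) * card ?B \<le> 2 * \<alpha> * card ?A"
    unfolding sumA sumB by (simp add: algebra_simps)
qed

section \<open>The process as prefixes of a random edge sequence\<close>

definition process_graph :: "nat \<Rightarrow> nat set list \<Rightarrow> nat \<Rightarrow> nat ugraph" where
  "process_graph n es j = \<lparr>verts = {..<n}, edges = set (take j es)\<rparr>"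

lemma graph_process_upto_draws:
  "graph_process_upto n i =
    map_pmf (\<lambda>es. map (process_graph n es) [0..<Suc i]) (draws i (all_edges {..<n}))"
proof (induction i)
  case 0
  then show ?case by (simp add: process_graph_def empty_graph_def)
next
  case (Suc i)
  let ?K = "all_edges {..<n}"
  \<comment> \<open>\<open>draws\<close> recurses on the first edge, the process on the last;
    splitting off a final block of length one reconciles them.\<close>
  have snoc: "draws (Suc i) ?K =
      bind_pmf (draws i ?K) (\<lambda>es. map_pmf (\<lambda>e. es @ [e]) (pmf_of_set (?K - set es)))"
    using draws_append[of i 1 ?K]
    by (simp add: map_bind_pmf map_pmf_def bind_assoc_pmf bind_return_pmf)
  have "graph_process_upto n (Suc i) = bind_pmf (draws i ?K) (\<lambda>es.
       let Gs = map (process_graph n es) [0..<Suc i] in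
       map_pmf (\<lambda>e. Gs @ [add_edge (last Gs) e]) (pmf_of_set (missing_edges (last Gs))))"
    by (simp add: Suc bind_map_pmf Let_def)
  also have "\<dots> = bind_pmf (draws i ?K) (\<lambda>es. map_pmf (\<lambda>e. map (process_graph n (es @ [e])) [0..<Suc (Suc i)])
       (pmf_of_set (?K - set es)))"
  proof (intro bind_pmf_cong refl)
    fix es assume "es \<in> set_pmf (draws i ?K)"
    then have len: "length es = i" by (rule length_draws)
    define Gs where "Gs = map (process_graph n es) [0..<Suc i]"
    have last: "last Gs = \<lparr>verts = {..<n}, edges = set es\<rparr>"
      using len by (simp add: Gs_def process_graph_def)
    have "missing_edges (last Gs) = ?K - set es"
      by (simp add: last missing_edges_def all_edges_def)
    moreover have "Gs @ [add_edge (last Gs) e] = map (process_graph n (es @ [e])) [0..<Suc (Suc i)]" for e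
      unfolding last unfolding Gs_def using len
      by (auto simp: process_graph_def add_edge_def)
    ultimately show "(let Gs = map (process_graph n es) [0..<Suc i] in
       map_pmf (\<lambda>e. Gs @ [add_edge (last Gs) e]) (pmf_of_set (missing_edges (last Gs)))) =
       map_pmf (\<lambda>e. map (process_graph n (es @ [e])) [0..<Suc (Suc i)]) (pmf_of_set (?K - set es))"
      by (simp only: Let_def flip: Gs_def)
  qed
  also have "\<dots> = map_pmf (\<lambda>es. map (process_graph n es) [0..<Suc (Suc i)]) (draws (Suc i) ?K)"
    unfolding snoc by (simp add: map_bind_pmf pmf.map_comp o_def del: upt_Suc)
  finally show ?case .
qed

text \<open>The deterministic part: \<open>isolated\<close> and \<open>covered\<close> trap the
  hitting time between \<open>m1\<close> and \<open>m2\<close>, so it suffices to exclude bad cuts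
  at all times in between. A deletion allowed by \<beta> is allowed by \<alpha>, which lets \<alpha>
  stay away from 0 when \<epsilon> is large.\<close>

lemma process_graph_resilient_at_tau1:
  fixes \<alpha> :: real
  assumes n: "n \<ge> 1" and es: "set es \<subseteq> all_edges {..<n}" and len: "length es = N"
    and m: "m1 \<le> m2" "m2 \<le> N"
    and isolated: "v < n" "\<forall>e\<in>set (take m1 es). v \<notin> e"
    and covered: "\<forall>v<n. \<exists>e\<in>set (take m2 es). v \<in> e"
    and \<alpha>: "\<beta> \<le> \<alpha>" "\<alpha> < 1 / 2"
    and cuts: "\<And>S m. \<lbrakk>S \<subseteq> {..<n}; S \<noteq> {}; 2 * card S \<le> n; m1 \<le> m; m \<le> m2;
      card S \<le> 2 * card (set (take m es) \<inter> all_edges S);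
      (1 - \<alpha>) * card (set (take m es) \<inter> crossing {..<n} S) \<le> 2 * \<alpha> * card (set (take m es) \<inter> all_edges S)\<rbrakk>
      \<Longrightarrow> False"
  defines "Gs \<equiv> map (process_graph n es) [0..<Suc N]"
  shows "resilient \<beta> connected_graph (Gs ! tau1 Gs)"
proof -
  have Gs: "Gs ! j = process_graph n es j" if "j \<le> N" for j
    unfolding Gs_def using that by (subst nth_map) (auto simp del: upt_Suc)
  have lenGs: "length Gs = Suc N" by (simp add: Gs_def)
  have min1: "min_degree (process_graph n es j) \<ge> 1 \<longleftrightarrow> (\<forall>v<n. \<exists>e\<in>set (take j es). v \<in> e)" for j
  proof -
    have ne: "{..<n} \<noteq> {}" using n by (auto simp: lessThan_empty_iff)
    have "min_degree (process_graph n es j) \<ge> 1 \<longleftrightarrow> (\<forall>v<n. 1 \<le> card {e \<in> set (take j es). v \<in> e})"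
      using ne by (auto simp: min_degree_def vdegree_def process_graph_def)
    also have "\<dots> \<longleftrightarrow> (\<forall>v<n. \<exists>e\<in>set (take j es). v \<in> e)"
      by (auto simp: Suc_le_eq card_gt_0_iff)
    finally show ?thesis .
  qed
  define t where "t = tau1 Gs"
  \<comment> \<open>\<open>m2\<close> witnesses the \<open>LEAST\<close> in \<open>tau1\<close>, so
    the latter is a genuine hitting time and at most \<open>m2\<close>.\<close>
  have ex: "m2 < length Gs \<and> min_degree (Gs ! m2) \<ge> 1"
    using m covered min1[of m2] by (simp add: lenGs Gs)
  have t2: "t \<le> m2" unfolding t_def tau1_def using ex by (rule Least_le)
  have "t < length Gs \<and> min_degree (Gs ! t) \<ge> 1"
    unfolding t_def tau1_def using ex by (rule LeastI)
  then have tN: "t \<le> N" and cov: "\<forall>v<n. \<exists>e\<in>set (take t es). v \<in> e"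
    using min1[of t] by (auto simp: lenGs Gs)
  have t1: "m1 \<le> t"
  proof (rule ccontr)
    assume "\<not> m1 \<le> t"
    then have "set (take t es) \<subseteq> set (take m1 es)" by (intro set_take_subset_set_take) simp
    then show False using cov isolated by blast
  qed
  let ?E = "set (take t es)" and ?V = "{..<n}"
  have E: "?E \<subseteq> all_edges ?V" using es set_take_subset[of t es] by blast
  have "resilient \<beta> connected_graph \<lparr>verts = ?V, edges = ?E\<rparr>"
    unfolding resilient_def
  proof (intro allI impI, rule ccontr)
    fix H
    assume H: "spanning_subgraph H \<lparr>verts = ?V, edges = ?E\<rparr> \<and>
        (\<forall>v\<in>verts \<lparr>verts = ?V, edges = ?E\<rparr>. real (vdegree H v) \<le> \<beta> * real (vdegree \<lparr>verts = ?V, edges = ?E\<rparr> v))"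
    assume "\<not> connected_graph (remove_edges_of \<lparr>verts = ?V, edges = ?E\<rparr> H)"
    then have "\<not> connected_graph \<lparr>verts = ?V, edges = ?E - edges H\<rparr>"
      by (simp add: remove_edges_of_def)
    then obtain S where S: "S \<subseteq> ?V" "S \<noteq> {}" "2 * card S \<le> card ?V" "?E \<inter> crossing ?V S \<subseteq> edges H"
      using disconnected_cut[of ?V ?E "edges H"] E n by (auto simp: lessThan_empty_iff)
    have HE: "edges H \<subseteq> ?E" using H by (simp add: spanning_subgraph_def)
    have deg: "card {e \<in> edges H. v \<in> e} \<le> \<alpha> * card {e \<in> ?E. v \<in> e}" if "v \<in> ?V" for v
    proof -
      have "card {e \<in> edges H. v \<in> e} \<le> \<beta> * card {e \<in> ?E. v \<in> e}"
        using H that by (simp add: vdegree_def)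
      also have "\<dots> \<le> \<alpha> * card {e \<in> ?E. v \<in> e}" using \<alpha> by (intro mult_right_mono) auto
      finally show ?thesis .
    qed
    have pos: "card {e \<in> ?E. v \<in> e} \<ge> 1" if "v \<in> ?V" for v
      using cov that by (auto simp: Suc_le_eq card_gt_0_iff)
    show False
      using cut_of_heavy_deletion[OF _ S(1,4) E HE deg pos \<alpha>(2)] S cuts[of S t] t1 t2 by auto
  qed
  then show ?thesis
    using Gs[OF tN] by (simp add: process_graph_def flip: t_def)
qed

section \<open>Isolated vertices\<close>

text \<open>Markov's inequality at threshold \<open>1\<close>. The hypotheses are restricted to the
  support, where the drawn edges are known to be distinct.\<close>

lemma prob_le_expectation:
  assumes "finite (set_pmf p)"
    and "\<And>x. x \<in> set_pmf p \<Longrightarrow> (0 :: real) \<le> f x" "\<And>x. \<lbrakk>x \<in> set_pmf p; Q x\<rbrakk> \<Longrightarrow> 1 \<le> f x"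
  shows "measure_pmf.prob p {x. Q x} \<le> measure_pmf.expectation p f"
proof -
  have "measure_pmf.prob p {x. Q x} = measure_pmf.expectation p (indicator {x. Q x})" by simp
  also have "\<dots> \<le> measure_pmf.expectation p f"
    using assms by (intro expectation_mono_pmf) (auto simp: indicator_def)
  finally show ?thesis .
qed

lemma prob_ex_le_sum:
  assumes "finite I"
  shows "measure_pmf.prob p {x. \<exists>i\<in>I. Q i x} \<le> (\<Sum>i\<in>I. measure_pmf.prob p {x. Q i x})"
proof -
  have "{x. \<exists>i\<in>I. Q i x} = (\<Union>i\<in>I. {x. Q i x})" by auto
  then show ?thesis
    using measure_pmf.finite_measure_subadditive_finite[OF assms, of "\<lambda>i. {x. Q i x}" p] by simp
qed

lemma sum_two_weights:
  fixes u v :: real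
  assumes "finite R" "A \<subseteq> R" "B \<subseteq> R" "A \<inter> B = {}"
  shows "(\<Sum>e\<in>R. (if e \<in> A then u else if e \<in> B then v else 1) - 1) = (u - 1) * card A + (v - 1) * card B"
proof -
  have "(\<Sum>e\<in>R. (if e \<in> A then u else if e \<in> B then v else 1) - 1)
      = (\<Sum>e\<in>A \<union> B. (if e \<in> A then u else if e \<in> B then v else 1) - 1)"
    using assms by (intro sum.mono_neutral_right) auto
  also have "\<dots> = (\<Sum>e\<in>A. u - 1) + (\<Sum>e\<in>B. v - 1)"
  proof -
    have "(\<Sum>e\<in>A. (if e \<in> A then u else if e \<in> B then v else 1) - 1) = (\<Sum>e\<in>A. u - 1)"
      by (intro sum.cong) auto
    moreover have "(\<Sum>e\<in>B. (if e \<in> A then u else if e \<in> B then v else 1) - 1) = (\<Sum>e\<in>B. v - 1)"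
      using assms by (intro sum.cong) auto
    moreover have "finite A" "finite B"
      using assms by (auto intro: finite_subset)
    ultimately show ?thesis
      using assms by (simp only: sum.union_disjoint)
  qed
  finally show ?thesis by (simp add: mult.commute)
qed

lemma prob_draws_avoid_le:
  assumes "finite R" "A \<subseteq> R" "m \<le> card R"
  shows "measure_pmf.prob (draws m R) {es. set es \<inter> A = {}} \<le> exp (- (m / card R * card A))"
proof -
  \<comment> \<open>Weight \<open>0\<close> on \<open>A\<close> makes the product the indicator of
    avoiding \<open>A\<close>, since \<open>0 ^ 0 = 1\<close>; the second class of the two-weight
    lemmas is taken empty.\<close>
  let ?w = "\<lambda>e. if e \<in> A then 0 else if e \<in> {} then 1 else (1 :: real)"
  have "measure_pmf.prob (draws m R) {es. set es \<inter> A = {}}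
      \<le> measure_pmf.expectation (draws m R) (\<lambda>es. prod_list (map ?w es))"
  proof (intro prob_le_expectation finite_set_pmf_draws assms)
    fix es assume "es \<in> set_pmf (draws m R)"
    then have eq: "prod_list (map ?w es) = 0 ^ card (set es \<inter> A) * 1 ^ card (set es \<inter> {})"
      using draws_distinct_subset[OF assms(1,3)] by (intro prod_list_two_weights) auto
    show "0 \<le> prod_list (map ?w es)" unfolding eq by simp
    show "1 \<le> prod_list (map ?w es)" if "set es \<inter> A = {}" unfolding eq using that by simp
  qed
  also have "\<dots> \<le> exp (m / card R * (\<Sum>e\<in>R. ?w e - 1))"
    using assms by (intro expectation_prod_draws_le_exp) auto
  also have "(\<Sum>e\<in>R. ?w e - 1) = - real (card A)"
    using sum_two_weights[of R A "{}" 0 1] assms by simp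
  finally show ?thesis by simp
qed

lemma real_card_all_edges:
  assumes "finite V"
  shows "real (card (all_edges V)) = card V * (real (card V) - 1) / 2"
proof (cases "card V = 0")
  case False
  have "even (card V * (card V - 1))"
    by (cases "card V") auto
  then have "2 * (card V choose 2) = card V * (card V - 1)"
    by (simp add: choose_two)
  then have "2 * real (card V choose 2) = card V * real (card V - 1)"
    by (metis of_nat_mult of_nat_numeral)
  moreover have "real (card V - 1) = real (card V) - 1"
    using False by (simp add: of_nat_diff Suc_leI)
  ultimately show ?thesis
    using assms by (simp add: card_all_edges)
qed (use assms in \<open>simp add: card_all_edges\<close>)

lemma star_eq_crossing: "v \<in> V \<Longrightarrow> {e \<in> all_edges V. v \<in> e} = crossing V {v}"
  by (auto simp: crossing_def all_edges_def subset_singleton_iff)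

lemma card_star: "\<lbrakk>finite V; v \<in> V\<rbrakk> \<Longrightarrow> card {e \<in> all_edges V. v \<in> e} = card V - 1"
  by (simp add: star_eq_crossing card_crossing)

text \<open>Inclusion-exclusion: two stars with \<open>card V - 1\<close> edges each share exactly
  the edge \<open>{u, v}\<close>.\<close>

lemma card_two_stars:
  assumes "finite V" "u \<in> V" "v \<in> V" "u \<noteq> v"
  shows "card {e \<in> all_edges V. u \<in> e \<or> v \<in> e} = 2 * card V - 3"
proof -
  let ?s = "\<lambda>v. {e \<in> all_edges V. v \<in> e}"
  have V: "card V \<ge> 2"
    using assms card_mono[of V "{u, v}"] by auto
  have "e = {u, v}" if "e \<in> all_edges V" "u \<in> e" "v \<in> e" for e
    using that assms by (auto simp: all_edges_def card_2_iff)
  then have int: "?s u \<inter> ?s v = {{u, v}}"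
    using assms by (auto simp: all_edges_def)
  have eq: "{e \<in> all_edges V. u \<in> e \<or> v \<in> e} = ?s u \<union> ?s v" by auto
  have "card (?s u) + card (?s v) = card (?s u \<union> ?s v) + card (?s u \<inter> ?s v)"
    by (intro card_Un_Int) (simp_all add: finite_all_edges assms(1))
  moreover have "card (?s u) = card V - 1" "card (?s v) = card V - 1"
    using assms by (simp_all add: card_star)
  moreover have "card (?s u \<inter> ?s v) = 1"
    unfolding int by simp
  ultimately show ?thesis
    unfolding eq using V by linarith
qed

section \<open>First and second moment of the number of isolated vertices\<close>

definition isolated_vertex :: "'a set set \<Rightarrow> 'a \<Rightarrow> bool" where
  "isolated_vertex E v \<longleftrightarrow> (\<forall>e\<in>E. v \<notin> e)"

lemma isolated_draws:
  assumes "finite V" "m \<le> card (all_edges V)" "es \<in> set_pmf (draws m (all_edges V))"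
  shows "isolated_vertex (set es) v \<longleftrightarrow> set es \<inter> {e \<in> all_edges V. v \<in> e} = {}"
  using draws_distinct_subset[OF finite_all_edges assms(2,3)] assms(1) by (auto simp: isolated_vertex_def)

lemma prob_pmf_cong:
  assumes "\<And>x. x \<in> set_pmf p \<Longrightarrow> Q x \<longleftrightarrow> Q' x"
  shows "measure_pmf.prob p {x. Q x} = measure_pmf.prob p {x. Q' x}"
  using assms by (intro measure_pmf.finite_measure_eq_AE) (auto simp: AE_measure_pmf_iff)

lemma prob_ex_isolated_le:
  assumes "finite V" "m \<le> card (all_edges V)"
  shows "measure_pmf.prob (draws m (all_edges V)) {es. \<exists>v\<in>V. isolated_vertex (set es) v}
    \<le> card V * exp (- (2 * m / card V))"
proof -
  let ?K = "all_edges V"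
  have "measure_pmf.prob (draws m ?K) {es. \<exists>v\<in>V. isolated_vertex (set es) v}
      \<le> (\<Sum>v\<in>V. measure_pmf.prob (draws m ?K) {es. isolated_vertex (set es) v})"
    using assms(1) by (rule prob_ex_le_sum)
  also have "\<dots> \<le> (\<Sum>v\<in>V. exp (- (2 * m / card V)))"
  proof (rule sum_mono)
    fix v assume v: "v \<in> V"
    have "measure_pmf.prob (draws m ?K) {es. isolated_vertex (set es) v}
        = measure_pmf.prob (draws m ?K) {es. set es \<inter> {e \<in> ?K. v \<in> e} = {}}"
      using isolated_draws[OF assms] by (intro prob_pmf_cong) auto
    also have "\<dots> \<le> exp (- (m / card ?K * card {e \<in> ?K. v \<in> e}))"
      using assms finite_all_edges by (intro prob_draws_avoid_le) auto
    \<comment> \<open>The star of \<open>v\<close> is a fraction \<open>2 / card V\<close> of all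
      pairs. With fewer than two vertices there are no pairs, and \<open>m = 0\<close>.\<close>
    also have "m / card ?K * card {e \<in> ?K. v \<in> e} = 2 * m / card V"
    proof (cases "card V \<ge> 2")
      case True
      then have "real (card V) - 1 \<noteq> 0" by simp
      then show ?thesis
        using True v assms(1) by (simp add: card_star real_card_all_edges of_nat_diff)
    next
      case False
      then have "card ?K = 0" using assms(1) by (simp add: card_all_edges)
      with assms(2) show ?thesis by simp
    qed
    finally show "measure_pmf.prob (draws m ?K) {es. isolated_vertex (set es) v} \<le> exp (- (2 * m / card V))" .
  qed
  finally show ?thesis by simp
qed

text \<open>Chebyshev's inequality. As no pair is positively correlated, the variance is at most the
  mean \<mu>, and a deviation by \<mu> has probability at most
  \<open>\<mu> / \<mu>\<^sup>2\<close>.\<close>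

lemma prob_zero_le_second_moment:
  fixes I :: "'i \<Rightarrow> 'a \<Rightarrow> bool" and q :: real
  assumes "finite V" "finite (set_pmf p)" "V \<noteq> {}" "q > 0"
    and single: "\<And>v. v \<in> V \<Longrightarrow> measure_pmf.prob p {x. I v x} = q"
    and pair: "\<And>u v. \<lbrakk>u \<in> V; v \<in> V; u \<noteq> v\<rbrakk> \<Longrightarrow> measure_pmf.prob p {x. I u x \<and> I v x} \<le> q\<^sup>2"
  shows "measure_pmf.prob p {x. \<not> (\<exists>v\<in>V. I v x)} \<le> 1 / (card V * q)"
proof -
  let ?E = "measure_pmf.expectation p"
  define X where "X x = (\<Sum>v\<in>V. indicator {x. I v x} x :: real)" for x :: 'a
  define \<mu> where "\<mu> = card V * q"
  have pos: "\<mu> > 0" using assms by (simp add: \<mu>_def card_gt_0_iff)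
  have int: "integrable (measure_pmf p) f" for f :: "'a \<Rightarrow> real"
    using assms(2) by (rule integrable_measure_pmf_finite)
  have EX: "?E X = \<mu>"
    unfolding X_def using int by (subst Bochner_Integration.integral_sum) (auto simp: single \<mu>_def)
  have "?E (\<lambda>x. (X x)\<^sup>2) = ?E (\<lambda>x. \<Sum>u\<in>V. \<Sum>v\<in>V. indicator {x. I u x \<and> I v x} x)"
    unfolding X_def power2_eq_square sum_product
    by (intro Bochner_Integration.integral_cong sum.cong refl) (auto simp: indicator_def)
  also have "\<dots> = (\<Sum>u\<in>V. \<Sum>v\<in>V. measure_pmf.prob p {x. I u x \<and> I v x})"
    using int by (simp add: Bochner_Integration.integral_sum)
  \<comment> \<open>The diagonal is bounded by \<open>q + q\<^sup>2\<close> rather than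
    \<open>q\<close>, so that the double sum splits.\<close>
  also have "\<dots> \<le> (\<Sum>u\<in>V. \<Sum>v\<in>V. (if u = v then q else 0) + q\<^sup>2)"
    using single pair assms(4) by (intro sum_mono) auto
  also have "\<dots> = \<mu> + \<mu>\<^sup>2"
    using assms(1) by (simp add: sum.distrib \<mu>_def power2_eq_square algebra_simps)
  finally have EX2: "?E (\<lambda>x. (X x)\<^sup>2) \<le> \<mu> + \<mu>\<^sup>2" .
  have "measure_pmf.prob p {x. \<not> (\<exists>v\<in>V. I v x)} \<le> ?E (\<lambda>x. (X x - \<mu>)\<^sup>2 / \<mu>\<^sup>2)"
    using assms(2) pos
    by (intro prob_le_expectation) (auto simp: X_def indicator_def)
  also have "\<dots> = ?E (\<lambda>x. (X x)\<^sup>2 - 2 * \<mu> * X x + \<mu>\<^sup>2) / \<mu>\<^sup>2"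
    by (simp add: power2_diff algebra_simps)
  also have "?E (\<lambda>x. (X x)\<^sup>2 - 2 * \<mu> * X x + \<mu>\<^sup>2) = ?E (\<lambda>x. (X x)\<^sup>2) - 2 * \<mu> * ?E X + \<mu>\<^sup>2"
    using int by simp
  also have "\<dots> / \<mu>\<^sup>2 \<le> \<mu> / \<mu>\<^sup>2"
    using EX EX2 by (intro divide_right_mono) (auto simp: power2_eq_square)
  also have "\<dots> = 1 / (card V * q)" using pos by (simp add: power2_eq_square flip: \<mu>_def)
  finally show ?thesis .
qed

text \<open>The exact products are compared factor by factor: those for a pair with the squares of
  those for one vertex, and the latter with their value at \<open>i = m\<close>, which is smallest.
  The slack \<open>2 * n\<close> keeps all factors positive.\<close>

lemma prob_no_isolated_le:
  assumes "finite V" "card V = n" "card (all_edges V) = N" "n \<ge> 2" "m + 2 * n \<le> N"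
  shows "measure_pmf.prob (draws m (all_edges V)) {es. \<not> (\<exists>v\<in>V. isolated_vertex (set es) v)}
    \<le> 1 / (n * (1 - (real n - 1) / (real N - m)) ^ m)"
proof -
  let ?K = "all_edges V"
  define q where "q = (\<Prod>i<m. (real N - (real n - 1) - real i) / (real N - real i))"
  have mN: "m \<le> card ?K" using assms by simp
  have V: "V \<noteq> {}" using assms by auto
  have "real N = n * (real n - 1) / 2"
    using real_card_all_edges[OF assms(1)] assms by simp
  also have "\<dots> \<le> (real n - 1)\<^sup>2"
  proof -
    have "0 \<le> (real n - 1) * (real n - 2)" using assms by simp
    then show ?thesis using assms by (simp add: power2_eq_square field_simps)
  qed
  finally have N: "real N \<le> (real n - 1)\<^sup>2" .
  have avoid: "measure_pmf.prob (draws m ?K) {es. set es \<inter> A = {}} =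
      (\<Prod>i<m. (real N - card A - real i) / (real N - real i))" if "A \<subseteq> ?K" for A
    using prob_draws_avoid[of ?K A m] that mN assms finite_all_edges by auto
  have single: "measure_pmf.prob (draws m ?K) {es. isolated_vertex (set es) v} = q" if "v \<in> V" for v
  proof -
    have "measure_pmf.prob (draws m ?K) {es. isolated_vertex (set es) v} =
        measure_pmf.prob (draws m ?K) {es. set es \<inter> {e \<in> ?K. v \<in> e} = {}}"
      using isolated_draws[OF assms(1) mN] by (intro prob_pmf_cong) auto
    also have "\<dots> = q"
      using that assms by (subst avoid) (auto simp: q_def card_star of_nat_diff)
    finally show ?thesis .
  qed
  have pair: "measure_pmf.prob (draws m ?K) {es. isolated_vertex (set es) u \<and> isolated_vertex (set es) v} \<le> q\<^sup>2"
    if "u \<in> V" "v \<in> V" "u \<noteq> v" for u v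
  proof -
    have "measure_pmf.prob (draws m ?K) {es. isolated_vertex (set es) u \<and> isolated_vertex (set es) v} =
        measure_pmf.prob (draws m ?K) {es. set es \<inter> {e \<in> ?K. u \<in> e \<or> v \<in> e} = {}}"
      using isolated_draws[OF assms(1) mN] by (intro prob_pmf_cong) auto
    also have "\<dots> = (\<Prod>i<m. (real N - (2 * real n - 3) - real i) / (real N - real i))"
      using that assms by (subst avoid) (auto simp: card_two_stars of_nat_diff)
    also have "\<dots> \<le> (\<Prod>i<m. ((real N - (real n - 1) - real i) / (real N - real i))\<^sup>2)"
    proof (intro prod_mono conjI)
      fix i assume "i \<in> {..<m}"
      then have x: "real N - real i > 0" "real N - real i \<le> (real n - 1)\<^sup>2" "real N - real i \<ge> 2 * real n"
        using assms N by auto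
      define x where "x = real N - real i"
      \<comment> \<open>After expansion this says \<open>x \<le> (real n - 1)\<^sup>2\<close>, which
        is where the bound on \<open>N\<close> enters.\<close>
      have "(x - (2 * real n - 3)) * x \<le> (x - (real n - 1))\<^sup>2"
        using x unfolding x_def[symmetric] by (simp add: power2_eq_square algebra_simps)
      then have "(x - (2 * real n - 3)) * x / x\<^sup>2 \<le> (x - (real n - 1))\<^sup>2 / x\<^sup>2"
        by (rule divide_right_mono) simp
      then have "(x - (2 * real n - 3)) / x \<le> ((x - (real n - 1)) / x)\<^sup>2"
        using x unfolding x_def[symmetric] by (simp add: power2_eq_square)
      then show "(real N - (2 * real n - 3) - real i) / (real N - real i)
          \<le> ((real N - (real n - 1) - real i) / (real N - real i))\<^sup>2"
        by (simp add: x_def algebra_simps)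
      show "0 \<le> (real N - (2 * real n - 3) - real i) / (real N - real i)"
        using x by simp
    qed
    also have "\<dots> = q\<^sup>2" by (simp add: q_def prod_power_distrib)
    finally show ?thesis .
  qed
  have lower: "(1 - (real n - 1) / (real N - m)) ^ m \<le> q" and pos: "(1 - (real n - 1) / (real N - m)) ^ m > 0"
  proof -
    have "(\<Prod>i<m. 1 - (real n - 1) / (real N - m)) \<le> q"
      unfolding q_def
    proof (intro prod_mono conjI)
      fix i assume i: "i \<in> {..<m}"
      have "real m + 2 * real n \<le> real N" using assms(5) by linarith
      with i assms(4) have "1 - (real n - 1) / (real N - m) \<le> 1 - (real n - 1) / (real N - real i)"
        by (intro diff_left_mono divide_left_mono mult_pos_pos) auto
      also have "\<dots> = (real N - (real n - 1) - real i) / (real N - real i)"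
        using i \<open>real m + 2 * real n \<le> real N\<close> by (simp add: field_simps)
      finally show "1 - (real n - 1) / (real N - m) \<le> (real N - (real n - 1) - real i) / (real N - real i)" .
      show "0 \<le> 1 - (real n - 1) / (real N - m)"
        using \<open>real m + 2 * real n \<le> real N\<close> assms(4) by (simp add: field_simps)
    qed
    then show "(1 - (real n - 1) / (real N - m)) ^ m \<le> q" by simp
    have "real m + 2 * real n \<le> real N" using assms(5) by linarith
    then show "(1 - (real n - 1) / (real N - m)) ^ m > 0"
      using assms(4) by (intro zero_less_power) (simp add: field_simps)
  qed
  have q: "q > 0" using pos lower by (rule less_le_trans)
  have "measure_pmf.prob (draws m ?K) {es. \<not> (\<exists>v\<in>V. isolated_vertex (set es) v)} \<le> 1 / (card V * q)"
    using assms(1) V single pair q mN finite_all_edges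
    by (intro prob_zero_le_second_moment finite_set_pmf_draws) auto
  also have "\<dots> \<le> 1 / (n * (1 - (real n - 1) / (real N - m)) ^ m)"
    using lower pos q assms by (intro divide_left_mono mult_left_mono mult_pos_pos) auto
  finally show ?thesis .
qed

section \<open>Cuts with too few crossing edges\<close>

text \<open>
  The exponential moment multiplies \<open>(10 s)\<^sup>2\<close> for each inner edge at the later time and \<open>1 / 10\<close> for each
  crossing edge at the earlier time: the powers of \<open>10\<close> pay for the second condition of the event, those
  of \<open>s\<close> for the first. Later \<open>s\<^sup>2 = n / (3000 |S|)\<close>.
\<close>

lemma prob_small_cut_le:
  fixes s :: real
  assumes "finite V" "S \<subseteq> V" and ab: "a + b \<le> card (all_edges V)" and s: "s \<ge> 1"
  defines "N \<equiv> card (all_edges V)"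
  shows "measure_pmf.prob (draws (a + b) (all_edges V))
      {es. card S \<le> 2 * card (set es \<inter> all_edges S) \<and>
        card (set (take a es) \<inter> crossing V S) \<le> 2 * card (set es \<inter> all_edges S)}
    \<le> (1 / s) ^ card S * exp (a / N * ((100 * s\<^sup>2 - 1) * card (all_edges S) - 9 / 10 * card (crossing V S))
        + b / (real N - a) * ((100 * s\<^sup>2 - 1) * card (all_edges S)))"
proof -
  let ?K = "all_edges V" and ?A = "all_edges S" and ?B = "crossing V S"
  let ?u = "100 * s\<^sup>2"
  let ?w = "\<lambda>e. if e \<in> ?A then ?u else if e \<in> ?B then 1 / 10 else 1"
  let ?w' = "\<lambda>e. if e \<in> ?A then ?u else if e \<in> {} then 1 else 1"
  let ?f = "\<lambda>es. (1 / s) ^ card S * (prod_list (map ?w (take a es)) * prod_list (map ?w' (drop a es)))"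
  have AB: "?A \<subseteq> ?K" "?B \<subseteq> ?K" "?A \<inter> ?B = {}"
    by (intro all_edges_mono crossing_subset all_edges_crossing_disjoint assms(2))+
  have finK: "finite ?K" using assms(1) by (rule finite_all_edges)
  have u1: "?u \<ge> 1" using one_le_power[OF s, of 2] by simp
  have f: "?f es = (1 / s) ^ card S * (?u ^ card (set es \<inter> ?A) * (1 / 10) ^ card (set (take a es) \<inter> ?B))"
    if "es \<in> set_pmf (draws (a + b) ?K)" for es
  proof -
    have dist: "distinct es" using draws_distinct_subset[OF finK ab that] by simp
    have two': "prod_list (map ?w' xs) = ?u ^ card (set xs \<inter> ?A)" if "distinct xs" for xs
      using prod_list_two_weights[OF that, of ?A "{}" ?u 1] by simp
    have "?u ^ card (set es \<inter> ?A) = prod_list (map ?w' (take a es @ drop a es))"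
      using two'[OF dist] by simp
    also have "\<dots> = ?u ^ card (set (take a es) \<inter> ?A) * prod_list (map ?w' (drop a es))"
      using two'[of "take a es"] dist by (simp only: map_append prod_list.append distinct_take)
    finally show ?thesis
      using prod_list_two_weights[OF distinct_take[OF dist] AB(3), of ?u "1 / 10" a]
      by (simp only: mult_ac)
  qed
  have "measure_pmf.prob (draws (a + b) ?K)
      {es. card S \<le> 2 * card (set es \<inter> ?A) \<and> card (set (take a es) \<inter> ?B) \<le> 2 * card (set es \<inter> ?A)}
    \<le> measure_pmf.expectation (draws (a + b) ?K) ?f"
  proof (rule prob_le_expectation[OF finite_set_pmf_draws[OF finK ab]])
    fix es assume es: "es \<in> set_pmf (draws (a + b) ?K)"
    show "0 \<le> ?f es" unfolding f[OF es] using s by simp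
    assume "card S \<le> 2 * card (set es \<inter> ?A) \<and> card (set (take a es) \<inter> ?B) \<le> 2 * card (set es \<inter> ?A)"
    then have "s ^ card S * 10 ^ card (set (take a es) \<inter> ?B)
        \<le> s ^ (2 * card (set es \<inter> ?A)) * 10 ^ (2 * card (set es \<inter> ?A))"
      using s by (intro mult_mono power_increasing) auto
    also have "\<dots> = ?u ^ card (set es \<inter> ?A)"
      by (simp only: power_mult power_mult_distrib) simp
    finally have "1 \<le> ?u ^ card (set es \<inter> ?A) / (s ^ card S * 10 ^ card (set (take a es) \<inter> ?B))"
      using s by (subst le_divide_eq_1_pos) auto
    then show "1 \<le> ?f es"
      unfolding f[OF es]
      by (simp only: power_one_over times_divide_eq_left times_divide_eq_right mult_1 mult_1_right
          divide_divide_eq_left mult.commute)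
  qed
  also have "\<dots> = (1 / s) ^ card S * measure_pmf.expectation (draws (a + b) ?K)
      (\<lambda>es. prod_list (map ?w (take a es)) * prod_list (map ?w' (drop a es)))"
    by simp
  also have "\<dots> \<le> (1 / s) ^ card S * exp (a / card ?K * (\<Sum>e\<in>?K. ?w e - 1)
      + b / (real (card ?K) - a) * (\<Sum>e\<in>?K. ?w' e - 1))"
    using s u1 by (intro mult_left_mono expectation_two_stage_draws_le finK ab) auto
  also have "(\<Sum>e\<in>?K. ?w e - 1) = (?u - 1) * card ?A - 9 / 10 * card ?B"
    using sum_two_weights[OF finK AB, of ?u "1 / 10"] by (simp only:) simp
  also have "(\<Sum>e\<in>?K. ?w' e - 1) = (?u - 1) * card ?A"
    using sum_two_weights[OF finK AB(1), of "{}" ?u 1] by simp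
  finally show ?thesis by (simp only: N_def)
qed

text \<open>Chernoff bound with tilt \<delta>. With k = \<open>card S\<close> and n =
  \<open>card V\<close> there are at most kn/4 inner and at least kn/2 crossing pairs. The linear
  terms of the exponent then give -\<delta>^2 kn, and the quadratic errors of the two exponentials
  cost three quarters of it.\<close>

lemma prob_balanced_cut_le:
  fixes \<alpha> \<delta> :: real
  assumes V: "finite V" "S \<subseteq> V" and m: "m \<le> card (all_edges V)" and \<delta>: "0 < \<delta>" "\<delta> \<le> 1 / 4"
    and half: "2 * card S \<le> card V"
  defines "\<alpha> \<equiv> 1 / 2 - \<delta>" and "N \<equiv> card (all_edges V)"
  shows "measure_pmf.prob (draws m (all_edges V))
      {es. (1 - \<alpha>) * card (set es \<inter> crossing V S) \<le> 2 * \<alpha> * card (set es \<inter> all_edges S)}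
    \<le> exp (- (m / N * (\<delta>\<^sup>2 / 4 * card S * card V)))"
proof -
  let ?K = "all_edges V" and ?A = "all_edges S" and ?B = "crossing V S"
  let ?u = "exp (2 * \<alpha> * \<delta>)" and ?v = "exp (- ((1 - \<alpha>) * \<delta>))"
  let ?w = "\<lambda>e. if e \<in> ?A then ?u else if e \<in> ?B then ?v else 1"
  define k n where "k = card S" and "n = card V"
  have AB: "?A \<subseteq> ?K" "?B \<subseteq> ?K" "?A \<inter> ?B = {}"
    by (intro all_edges_mono crossing_subset all_edges_crossing_disjoint V(2))+
  have finK: "finite ?K" using V(1) by (rule finite_all_edges)
  have \<alpha>: "\<alpha> \<ge> 1 / 4" "\<alpha> < 1 / 2" using \<delta> by (auto simp: \<alpha>_def)
  have "measure_pmf.prob (draws m ?K) {es. (1 - \<alpha>) * card (set es \<inter> ?B) \<le> 2 * \<alpha> * card (set es \<inter> ?A)}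
      \<le> measure_pmf.expectation (draws m ?K) (\<lambda>es. prod_list (map ?w es))"
  proof (rule prob_le_expectation[OF finite_set_pmf_draws[OF finK m]])
    fix es assume es: "es \<in> set_pmf (draws m ?K)"
    have "prod_list (map ?w es) = ?u ^ card (set es \<inter> ?A) * ?v ^ card (set es \<inter> ?B)"
      using draws_distinct_subset[OF finK m es] AB by (intro prod_list_two_weights) auto
    also have "\<dots> = exp (\<delta> * (2 * \<alpha> * card (set es \<inter> ?A) - (1 - \<alpha>) * card (set es \<inter> ?B)))"
      by (simp flip: exp_of_nat_mult exp_add) (simp add: algebra_simps)
    finally have eq: "prod_list (map ?w es) = exp (\<delta> * (2 * \<alpha> * card (set es \<inter> ?A) - (1 - \<alpha>) * card (set es \<inter> ?B)))" .
    show "0 \<le> prod_list (map ?w es)" unfolding eq by simp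
    show "1 \<le> prod_list (map ?w es)"
      if "(1 - \<alpha>) * card (set es \<inter> ?B) \<le> 2 * \<alpha> * card (set es \<inter> ?A)"
      unfolding eq using that \<delta> by simp
  qed
  also have "\<dots> \<le> exp (m / N * (\<Sum>e\<in>?K. ?w e - 1))"
    unfolding N_def using finK m by (intro expectation_prod_draws_le_exp) auto
  also have "\<dots> \<le> exp (m / N * (- (\<delta>\<^sup>2 / 4 * k * n)))"
  proof (intro iffD2[OF exp_le_cancel_iff] mult_left_mono)
    have finS: "finite S" using V by (rule finite_subset[rotated])
    have kn: "k \<le> n" "2 * real k \<le> real n" using half by (auto simp: k_def n_def)
    have A: "real (card ?A) \<le> k * n / 4"
    proof -
      have "real (card ?A) = k * (real k - 1) / 2" using real_card_all_edges[OF finS] by (simp add: k_def)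
      also have "\<dots> \<le> k * (n / 2) / 2" using kn by (intro divide_right_mono mult_left_mono) auto
      finally show ?thesis by simp
    qed
    have B: "real (card ?B) \<ge> k * n / 2"
    proof -
      have "real (card ?B) = k * (real n - real k)"
        using card_crossing[OF V(2,1)] kn by (simp add: k_def n_def of_nat_diff)
      also have "\<dots> \<ge> k * (n / 2)" using kn by (intro mult_left_mono) auto
      finally show ?thesis by simp
    qed
    have z: "0 \<le> 2 * \<alpha> * \<delta>" "2 * \<alpha> * \<delta> \<le> 1 * \<delta>"
      using \<alpha> \<delta> by (auto intro: mult_right_mono)
    have u: "?u - 1 \<le> 2 * \<alpha> * \<delta> + \<delta>\<^sup>2"
    proof -
      have "?u \<le> 1 + 2 * \<alpha> * \<delta> + (2 * \<alpha> * \<delta>)\<^sup>2" using z \<delta> by (intro exp_bound) linarith+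
      also have "(2 * \<alpha> * \<delta>)\<^sup>2 \<le> \<delta>\<^sup>2" using z by (intro power_mono) auto
      finally show ?thesis by simp
    qed
    have v: "1 - ?v \<ge> (1 - \<alpha>) * \<delta> - \<delta>\<^sup>2"
    proof -
      define y where "y = (1 - \<alpha>) * \<delta>"
      have y: "0 \<le> y" "y \<le> 1 * \<delta>" using \<alpha> \<delta> unfolding y_def by (auto intro: mult_right_mono)
      have "?v = 1 / exp y" by (simp only: y_def[symmetric] exp_minus inverse_eq_divide)
      also have "\<dots> \<le> 1 / (1 + y)" using y by (intro divide_left_mono exp_ge_add_one_self) auto
      also have "\<dots> \<le> 1 - y + y\<^sup>2"
        using y by (simp add: field_simps power2_eq_square)
      also have "y\<^sup>2 \<le> \<delta>\<^sup>2" using y by (intro power_mono) auto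
      finally show ?thesis by (simp add: y_def)
    qed
    \<comment> \<open>This sign allows the lower bounds for \<open>1 - ?v\<close> and for the number
      of crossing pairs to be multiplied.\<close>
    have pos: "(1 - \<alpha>) * \<delta> - \<delta>\<^sup>2 \<ge> 0"
    proof -
      have "\<delta> * \<delta> \<le> (1 - \<alpha>) * \<delta>" using \<alpha> \<delta> by (intro mult_right_mono) auto
      then show ?thesis by (simp add: power2_eq_square)
    qed
    have "(\<Sum>e\<in>?K. ?w e - 1) = (?u - 1) * card ?A - (1 - ?v) * card ?B"
      using sum_two_weights[OF finK AB, of ?u ?v] by (simp only:) (simp add: algebra_simps)
    also have "\<dots> \<le> (2 * \<alpha> * \<delta> + \<delta>\<^sup>2) * (k * n / 4) - ((1 - \<alpha>) * \<delta> - \<delta>\<^sup>2) * (k * n / 2)"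
      by (rule diff_mono[OF mult_mono mult_mono]) (use u v A B pos z \<alpha> \<delta> in auto)
    also have "\<dots> = - (\<delta>\<^sup>2 / 4 * k * n)"
      by (simp add: \<alpha>_def field_simps power2_eq_square)
    finally show "(\<Sum>e\<in>?K. ?w e - 1) \<le> - (\<delta>\<^sup>2 / 4 * k * n)" .
  qed simp
  finally show ?thesis by (simp add: k_def n_def)
qed

section \<open>Union bounds over cuts\<close>

lemma power_self_le_exp_fact: "real k ^ k \<le> exp k * fact k"
proof -
  have s: "(\<lambda>i. real k ^ i /\<^sub>R fact i) sums exp (real k)" by (rule exp_converges)
  have "(\<Sum>i\<in>{k}. real k ^ i /\<^sub>R fact i) \<le> (\<Sum>i. real k ^ i /\<^sub>R fact i)"
    using s by (intro sum_le_suminf) (auto simp: sums_iff)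
  then show ?thesis using s by (simp add: sums_iff field_simps)
qed

text \<open>Taking roots in \<open>k ^ k \<le> 4 ^ k * (fact k)\<^sup>2\<close> gives
  \<open>sqrt k ^ k \<le> 2 ^ k * fact k\<close>, and the factorial cancels against the binomial
  coefficient. In the union bound this absorbs the factor \<open>sqrt k\<close> per vertex that
  comes from \<open>1 / s\<close>.\<close>

lemma choose_mult_sqrt_power_le:
  "real (n choose k) * sqrt k ^ k \<le> (2 * real n) ^ k"
proof -
  have "(sqrt k ^ k)\<^sup>2 = real k ^ k"
    by (simp add: power_mult[symmetric] mult.commute[of k 2]) (simp add: power_mult)
  also have "\<dots> \<le> exp k * fact k" by (rule power_self_le_exp_fact)
  also have "exp (real k) \<le> 4 ^ k"
  proof -
    have "exp (real k) = exp 1 ^ k" by (simp flip: exp_of_nat_mult)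
    also have "\<dots> \<le> 4 ^ k" using exp_le by (intro power_mono) auto
    finally show ?thesis .
  qed
  also have "4 ^ k * fact k \<le> 4 ^ k * (fact k * fact k :: real)"
    by simp
  also have "\<dots> = (2 ^ k * fact k)\<^sup>2"
  proof -
    have "(4 :: real) ^ k = (2 ^ k)\<^sup>2" by (simp add: power_even_eq[symmetric] power_mult)
    then show ?thesis by (simp add: power_mult_distrib power2_eq_square)
  qed
  finally have le: "sqrt k ^ k \<le> 2 ^ k * fact k"
    by (rule power2_le_imp_le) simp_all
  have "real (n choose k) * sqrt k ^ k \<le> real (n choose k) * (2 ^ k * fact k)"
    using le by (intro mult_left_mono) auto
  also have "\<dots> = 2 ^ k * real ((n choose k) * fact k)" by simp
  also have "\<dots> \<le> 2 ^ k * real (n ^ k)"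
    using binomial_fact_pow[of n k] by (intro mult_left_mono) (simp_all only: of_nat_le_iff, simp)
  finally show ?thesis by (simp add: power_mult_distrib)
qed

lemma sum_Pow_card:
  fixes g :: "nat \<Rightarrow> real"
  assumes "finite V"
  shows "(\<Sum>S\<in>Pow V. g (card S)) = (\<Sum>k\<le>card V. (card V choose k) * g k)"
proof -
  have "(\<Sum>S\<in>Pow V. g (card S)) = (\<Sum>k\<le>card V. \<Sum>S\<in>{S \<in> Pow V. card S = k}. g (card S))"
    using assms by (intro sum.group[symmetric]) (auto intro: card_mono)
  also have "\<dots> = (\<Sum>k\<le>card V. (card V choose k) * g k)"
    using assms by (intro sum.cong refl) (simp add: n_subsets)
  finally show ?thesis .
qed

text \<open>A set of size k costs a factor of order sqrt(k/n) n^(-0.65) per vertex. Together with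
  the number of such sets this is at most \<open>r ^ k\<close>, where \<open>r\<close> has order
  n^(-0.15), and a geometric series remains.\<close>

lemma prob_ex_small_cut_le:
  fixes L :: real
  assumes V: "finite V" "card V = n" "card (all_edges V) = N" and ab: "a + b \<le> N" and n: "n \<ge> 1"
    and L: "L = ln n / n" "a / N \<ge> 78 / 100 * L" "a / N + b / (real N - a) \<le> 3 * L"
    and r: "r = 2 * sqrt (3000 * real n) * exp (- (65 / 100 * ln n))" "r \<le> 1 / 2"
  shows "measure_pmf.prob (draws (a + b) (all_edges V))
      {es. \<exists>S\<in>{S. S \<subseteq> V \<and> S \<noteq> {} \<and> 3000 * card S \<le> n}. card S \<le> 2 * card (set es \<inter> all_edges S) \<and>
        card (set (take a es) \<inter> crossing V S) \<le> 2 * card (set es \<inter> all_edges S)} \<le> 2 * r"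
    (is "measure_pmf.prob ?p {es. \<exists>S\<in>?F. ?Q S es} \<le> _")
proof -
  \<comment> \<open>The value \<open>0\<close> at \<open>k = 0\<close> allows the sum over
    \<open>?F\<close> to be extended to all subsets, including the empty one.\<close>
  define g where "g k = (if k = 0 then 0 else (sqrt (3000 * k / n) * exp (- (65 / 100 * ln n))) ^ k)" for k :: nat
  have g0: "g k \<ge> 0" for k by (simp add: g_def)
  have L0: "L \<ge> 0" using n by (simp add: L)
  have each: "measure_pmf.prob ?p {es. ?Q S es} \<le> g (card S)" if "S \<in> ?F" for S
  proof -
    define k where "k = card S"
    have finS: "finite S" using that V by (auto intro: finite_subset)
    then have k: "k \<ge> 1" "3000 * real k \<le> n" using that by (auto simp: k_def Suc_le_eq card_gt_0_iff)
    \<comment> \<open>This \<open>s\<close> balances the weight of inner edges: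
      \<open>100 * s\<^sup>2\<close> times k^2/2 is only kn/60. The threshold
      \<open>3000 * card S \<le> n\<close> gives \<open>s \<ge> 1\<close>.\<close>
    define s where "s = sqrt (n / (3000 * k))"
    have s1: "s \<ge> 1" using k by (simp add: s_def)
    have s2: "s\<^sup>2 = n / (3000 * k)" by (simp add: s_def)
    let ?A = "real (card (all_edges S))" and ?B = "real (card (crossing V S))"
    have A: "?A \<le> real k * k / 2"
    proof -
      have "?A = k * (real k - 1) / 2" using real_card_all_edges[OF finS] by (simp add: k_def)
      also have "\<dots> \<le> real k * real k / 2" by (intro divide_right_mono mult_left_mono) auto
      finally show ?thesis .
    qed
    have B: "?B \<ge> 2999 / 3000 * (real k * n)"
    proof -
      have "?B = k * (real n - real k)"
        using card_crossing[of S V] that V k by (simp add: k_def of_nat_diff)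
      also have "\<dots> \<ge> k * (2999 / 3000 * n)" using k by (intro mult_left_mono) auto
      finally show ?thesis by (simp add: mult_ac)
    qed
    have Apos: "0 \<le> (100 * s\<^sup>2 - 1) * ?A"
      using one_le_power[OF s1, of 2] by (intro mult_nonneg_nonneg) auto
    have bpos: "0 \<le> b / (real N - a)" using ab by (simp del: of_nat_add flip: of_nat_diff)
    have "a / N * ((100 * s\<^sup>2 - 1) * ?A - 9 / 10 * ?B) + b / (real N - a) * ((100 * s\<^sup>2 - 1) * ?A)
        = (a / N + b / (real N - a)) * ((100 * s\<^sup>2 - 1) * ?A) - 9 / 10 * (a / N * ?B)"
      by (simp add: algebra_simps)
    also have "\<dots> \<le> (3 * L) * ((100 * s\<^sup>2) * (real k * k / 2)) - 9 / 10 * ((78 / 100 * L) * (2999 / 3000 * (real k * n)))"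
      using L L0 A B s1 bpos Apos by (intro diff_mono mult_mono mult_left_mono) auto
    also have "(100 * s\<^sup>2) * (real k * k / 2) = k * n / 60"
      using k by (simp add: s2 field_simps)
    also have "3 * L * (k * n / 60) - 9 / 10 * ((78 / 100 * L) * (2999 / 3000 * (real k * n)))
        = (1 / 20 - 9 / 10 * (78 / 100) * (2999 / 3000)) * (real k * n * L)"
      by (simp add: algebra_simps)
    \<comment> \<open>Inner edges cost 0.05 and missing crossing edges gain about 0.7017, so 0.65 is
      left; anything above 1/2 would make \<open>r\<close> tend to 0.\<close>
    also have "\<dots> \<le> (- (65 / 100)) * (real k * n * L)"
      using L0 by (intro mult_right_mono) auto
    also have "\<dots> = k * (- (65 / 100 * ln n))" using n by (simp add: L)
    finally have expo: "a / N * ((100 * s\<^sup>2 - 1) * ?A - 9 / 10 * ?B) + b / (real N - a) * ((100 * s\<^sup>2 - 1) * ?A)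
        \<le> k * (- (65 / 100 * ln n))" .
    have "measure_pmf.prob ?p {es. ?Q S es} \<le> (1 / s) ^ k *
        exp (a / N * ((100 * s\<^sup>2 - 1) * ?A - 9 / 10 * ?B) + b / (real N - a) * ((100 * s\<^sup>2 - 1) * ?A))"
      using prob_small_cut_le[of V S a b s] V that ab s1 by (simp add: k_def)
    also have "\<dots> \<le> (1 / s) ^ k * exp (k * (- (65 / 100 * ln n)))"
      using expo s1 by (intro mult_left_mono) auto
    also have "1 / s = sqrt (3000 * k / n)"
      by (simp add: s_def real_sqrt_divide)
    also have "sqrt (3000 * k / n) ^ k * exp (k * (- (65 / 100 * ln n))) = g k"
      using k by (simp only: g_def exp_of_nat_mult power_mult_distrib) simp
    finally show ?thesis by (simp add: k_def)
  qed
  have binom_g: "real (n choose k) * g k \<le> (if k = 0 then 0 else r ^ k)" for k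
  proof (cases "k = 0")
    case False
    have "real (n choose k) * g k
        = (real (n choose k) * sqrt k ^ k) * (sqrt (3000 / n) * exp (- (65 / 100 * ln n))) ^ k"
      using False by (simp add: g_def power_mult_distrib[symmetric] mult_ac real_sqrt_mult real_sqrt_divide)
    also have "\<dots> \<le> (2 * real n) ^ k * (sqrt (3000 / n) * exp (- (65 / 100 * ln n))) ^ k"
      by (intro mult_right_mono choose_mult_sqrt_power_le) simp
    also have "\<dots> = (2 * (n * sqrt (3000 / n)) * exp (- (65 / 100 * ln n))) ^ k"
      by (simp add: power_mult_distrib mult_ac)
    also have "n * sqrt (3000 / n) = sqrt (3000 * real n)"
      using n by (simp add: real_sqrt_divide real_sqrt_mult real_div_sqrt field_simps)
    finally show ?thesis using False by (simp add: r)
  qed (simp add: g_def)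
  have "measure_pmf.prob ?p {es. \<exists>S\<in>?F. ?Q S es} \<le> (\<Sum>S\<in>?F. measure_pmf.prob ?p {es. ?Q S es})"
    by (rule prob_ex_le_sum, rule finite_subset[of _ "Pow V"]) (use V in auto)
  also have "\<dots> \<le> (\<Sum>S\<in>?F. g (card S))" by (intro sum_mono each)
  also have "\<dots> \<le> (\<Sum>S\<in>Pow V. g (card S))"
    using V g0 by (intro sum_mono2) auto
  also have "\<dots> = (\<Sum>k\<le>n. (n choose k) * g k)" using sum_Pow_card[OF V(1)] V by simp
  also have "\<dots> \<le> (\<Sum>k\<le>n. if k = 0 then 0 else r ^ k)"
    by (intro sum_mono binom_g)
  also have "\<dots> = (\<Sum>k<n. r ^ Suc k)"
    by (subst lessThan_Suc_atMost[symmetric], subst sum.lessThan_Suc_shift) simp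
  also have "\<dots> = r * (\<Sum>k<n. r ^ k)" by (simp add: sum_distrib_left)
  also have "\<dots> \<le> r * (\<Sum>k<n. (1 / 2) ^ k)"
    using r by (intro mult_left_mono sum_mono power_mono) auto
  also have "\<dots> \<le> r * 2"
    using r by (intro mult_left_mono) (auto simp: sum_gp_strict)
  finally show ?thesis by simp
qed

text \<open>For sets of at least n/3000 vertices each failure probability is exp(-c n ln n), small
  enough for a plain union bound over at most \<open>2 ^ n\<close> sets and \<open>m2 + 1\<close>
  times.\<close>

lemma prob_ex_balanced_cut_le:
  fixes \<alpha> \<delta> L :: real
  assumes V: "finite V" "card V = n" "card (all_edges V) = N" and m: "m1 \<le> m2" "m2 \<le> N" and n: "n \<ge> 1"
    and \<delta>: "0 < \<delta>" "\<delta> \<le> 1 / 4" and L: "L = ln n / n" "m1 / N \<ge> 78 / 100 * L"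
  defines "\<alpha> \<equiv> 1 / 2 - \<delta>"
  shows "measure_pmf.prob (draws N (all_edges V))
      {es. \<exists>(m, S)\<in>{m1..m2} \<times> {S. S \<subseteq> V \<and> 2 * card S \<le> n \<and> n \<le> 3000 * card S}.
        (1 - \<alpha>) * card (set (take m es) \<inter> crossing V S) \<le> 2 * \<alpha> * card (set (take m es) \<inter> all_edges S)}
    \<le> (real m2 + 1) * 2 ^ n * exp (- (\<delta>\<^sup>2 / 20000 * n * ln n))"
    (is "measure_pmf.prob ?p {es. \<exists>(m, S)\<in>?M \<times> ?F. ?Q m S es} \<le> _")
proof -
  have L0: "L \<ge> 0" using n by (simp add: L)
  have each: "measure_pmf.prob ?p {es. ?Q m S es} \<le> exp (- (\<delta>\<^sup>2 / 20000 * n * ln n))"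
    if "m \<in> ?M" "S \<in> ?F" for m S
  proof -
    have mN: "m \<le> N" using that m by simp
    have "measure_pmf.prob ?p {es. ?Q m S es} = measure_pmf.prob (draws m (all_edges V))
        {es. (1 - \<alpha>) * card (set es \<inter> crossing V S) \<le> 2 * \<alpha> * card (set es \<inter> all_edges S)}"
      by (rule prob_take_draws[OF mN])
    also have "\<dots> \<le> exp (- (m / N * (\<delta>\<^sup>2 / 4 * card S * n)))"
      using prob_balanced_cut_le[of V S m \<delta>] V that mN \<delta> by (simp add: \<alpha>_def)
    also have "\<dots> \<le> exp (- (\<delta>\<^sup>2 / 20000 * n * ln n))"
    proof -
      have "78 / 100 * L \<le> m / N"
        using that by (intro order_trans[OF L(2)] divide_right_mono) auto
      then have "(78 / 100 * L) * (\<delta>\<^sup>2 / 4 * (n / 3000) * n) \<le> m / N * (\<delta>\<^sup>2 / 4 * card S * n)"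
      proof (rule mult_mono)
        show "\<delta>\<^sup>2 / 4 * (n / 3000) * n \<le> \<delta>\<^sup>2 / 4 * card S * n"
          using that by (intro mult_left_mono mult_right_mono) auto
      qed simp_all
      also have "(78 / 100 * L) * (\<delta>\<^sup>2 / 4 * (n / 3000) * n) = (78 / 1200000) * (\<delta>\<^sup>2 * n * ln n)"
        using n by (simp add: L)
      finally have "(78 / 1200000) * (\<delta>\<^sup>2 * n * ln n) \<le> m / N * (\<delta>\<^sup>2 / 4 * card S * n)" .
      \<comment> \<open>The constant 0.78 / 12000 is rounded down to 1 / 20000.\<close>
      moreover have "(1 / 20000) * (\<delta>\<^sup>2 * n * ln n) \<le> (78 / 1200000) * (\<delta>\<^sup>2 * n * ln n)"
        using n by (intro mult_right_mono) auto
      moreover have "\<delta>\<^sup>2 / 20000 * n * ln n = (1 / 20000) * (\<delta>\<^sup>2 * n * ln n)" by simp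
      ultimately show ?thesis by (simp only: exp_le_cancel_iff neg_le_iff_le)
    qed
    finally show ?thesis .
  qed
  have finF: "finite ?F" "card ?F \<le> 2 ^ n"
  proof -
    have sub: "?F \<subseteq> Pow V" by auto
    with V show "finite ?F" by (auto intro: finite_subset)
    show "card ?F \<le> 2 ^ n" using card_mono[OF _ sub] V by (simp add: card_Pow)
  qed
  have "measure_pmf.prob ?p {es. \<exists>x\<in>?M \<times> ?F. case x of (m, S) \<Rightarrow> ?Q m S es}
      \<le> (\<Sum>x\<in>?M \<times> ?F. measure_pmf.prob ?p {es. case x of (m, S) \<Rightarrow> ?Q m S es})"
    using finF by (intro prob_ex_le_sum) auto
  also have "\<dots> \<le> (\<Sum>x\<in>?M \<times> ?F. exp (- (\<delta>\<^sup>2 / 20000 * n * ln n)))"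
  proof (rule sum_mono)
    fix x assume "x \<in> ?M \<times> ?F"
    then obtain m S where "x = (m, S)" "m \<in> ?M" "S \<in> ?F" by blast
    then show "measure_pmf.prob ?p {es. case x of (m, S) \<Rightarrow> ?Q m S es} \<le> exp (- (\<delta>\<^sup>2 / 20000 * n * ln n))"
      using each[of m S] by simp
  qed
  also have "\<dots> = real (card ?M * card ?F) * exp (- (\<delta>\<^sup>2 / 20000 * n * ln n))"
    by (simp add: card_cartesian_product)
  also have "\<dots> \<le> ((real m2 + 1) * 2 ^ n) * exp (- (\<delta>\<^sup>2 / 20000 * n * ln n))"
  proof (intro mult_right_mono)
    have "card ?M * card ?F \<le> (m2 + 1) * 2 ^ n"
      using finF(2) by (intro mult_mono) auto
    then have "real (card ?M * card ?F) \<le> real ((m2 + 1) * 2 ^ n)" by (rule of_nat_mono)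
    then show "real (card ?M * card ?F) \<le> (real m2 + 1) * 2 ^ n" by (simp add: algebra_simps)
  qed simp
  finally show ?thesis by (simp add: case_prod_beta)
qed

section \<open>Resilience at the hitting time\<close>

text \<open>The four error terms belong to four bad events: a vertex still isolated at
  \<open>m2\<close>, none isolated at \<open>m1\<close>, a bad small cut, a bad large cut. Outside
  them the deterministic part applies.\<close>

lemma prob_process_resilient_ge:
  fixes \<epsilon> \<delta> L r :: real
  assumes n: "n \<ge> 2" and N: "N = n choose 2" and m: "m1 \<le> m2" "m2 \<le> N" "m1 + 2 * n \<le> N"
    and \<delta>: "0 < \<delta>" "\<delta> \<le> 1 / 4" "\<delta> \<le> \<epsilon>"
    and L: "L = ln n / n" "m1 / N \<ge> 78 / 100 * L" "m1 / N + (real m2 - m1) / (real N - m1) \<le> 3 * L"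
    and r: "r = 2 * sqrt (3000 * real n) * exp (- (65 / 100 * ln n))" "r \<le> 1 / 2"
  shows "measure_pmf.prob (random_graph_process n)
      {Gs. resilient (1 / 2 - \<epsilon>) connected_graph (Gs ! tau1 Gs)}
    \<ge> 1 - (n * exp (- (2 * real m2 / n)) + 1 / (n * (1 - (real n - 1) / (real N - m1)) ^ m1) + 2 * r
        + (real m2 + 1) * 2 ^ n * exp (- (\<delta>\<^sup>2 / 20000 * n * ln n)))"
proof -
  let ?V = "{..<n}" and ?K = "all_edges {..<n}"
  let ?p = "draws N ?K"
  define \<alpha> where "\<alpha> = 1 / 2 - \<delta>"
  define good where "good es \<longleftrightarrow> resilient (1 / 2 - \<epsilon>) connected_graph
    (map (process_graph n es) [0..<Suc N] ! tau1 (map (process_graph n es) [0..<Suc N]))" for es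
  have V: "finite ?V" "card ?V = n" "card ?K = N" by (simp_all add: card_all_edges N)
  define F1 where "F1 = {S. S \<subseteq> ?V \<and> S \<noteq> {} \<and> 3000 * card S \<le> n}"
  define F2 where "F2 = {S. S \<subseteq> ?V \<and> 2 * card S \<le> n \<and> n \<le> 3000 * card S}"
  define E1 where "E1 = {es. \<exists>v\<in>?V. isolated_vertex (set (take m2 es)) v}"
  define E2 where "E2 = {es. \<not> (\<exists>v\<in>?V. isolated_vertex (set (take m1 es)) v)}"
  define small where "small es \<longleftrightarrow> (\<exists>S\<in>F1. card S \<le> 2 * card (set es \<inter> all_edges S) \<and>
      card (set (take m1 es) \<inter> crossing ?V S) \<le> 2 * card (set es \<inter> all_edges S))" for es
  define E3 where "E3 = {es. small (take m2 es)}"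
  define E4 where "E4 = {es. \<exists>(m, S)\<in>{m1..m2} \<times> F2.
      (1 - \<alpha>) * card (set (take m es) \<inter> crossing ?V S) \<le> 2 * \<alpha> * card (set (take m es) \<inter> all_edges S)}"
  have P1: "measure_pmf.prob ?p E1 \<le> n * exp (- (2 * real m2 / n))"
    unfolding E1_def using prob_ex_isolated_le[OF V(1), of m2] m V by (subst prob_take_draws) auto
  have P2: "measure_pmf.prob ?p E2 \<le> 1 / (n * (1 - (real n - 1) / (real N - m1)) ^ m1)"
    unfolding E2_def using prob_no_isolated_le[OF V n m(3)] m by (subst prob_take_draws) auto
  have P3: "measure_pmf.prob ?p E3 \<le> 2 * r"
  proof -
    have "measure_pmf.prob ?p E3 = measure_pmf.prob (draws (m1 + (m2 - m1)) ?K) {es. small es}"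
      unfolding E3_def using m by (subst prob_take_draws) auto
    also have "\<dots> \<le> 2 * r"
      unfolding small_def F1_def
      by (rule prob_ex_small_cut_le[OF V _ _ L(1,2) _ r]) (use m n L(3) in \<open>simp_all add: of_nat_diff\<close>)
    finally show ?thesis .
  qed
  have P4: "measure_pmf.prob ?p E4 \<le> (real m2 + 1) * 2 ^ n * exp (- (\<delta>\<^sup>2 / 20000 * n * ln n))"
    unfolding E4_def F2_def \<alpha>_def using n by (intro prob_ex_balanced_cut_le[OF V m(1,2) _ \<delta>(1,2) L(1,2)]) auto
  have good: "good es" if es: "es \<in> set_pmf ?p" and nE: "es \<notin> E1 \<union> E2 \<union> E3 \<union> E4" for es
  proof -
    have len: "length es = N" using es by (rule length_draws)
    have sub: "set es \<subseteq> ?K"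
      using draws_distinct_subset[OF finite_all_edges[OF V(1)] _ es] V by simp
    obtain v where v: "v < n" "\<forall>e\<in>set (take m1 es). v \<notin> e"
      using nE by (auto simp: E2_def isolated_vertex_def)
    have cov: "\<forall>v<n. \<exists>e\<in>set (take m2 es). v \<in> e"
      using nE by (auto simp: E1_def isolated_vertex_def)
    show ?thesis
      unfolding good_def
    proof (rule process_graph_resilient_at_tau1[OF _ sub len m(1,2) v cov, of _ \<alpha>])
      fix S m assume S: "S \<subseteq> ?V" "S \<noteq> {}" "2 * card S \<le> n" and m12: "m1 \<le> m" "m \<le> m2"
        and heavy: "card S \<le> 2 * card (set (take m es) \<inter> all_edges S)"
        and cut: "(1 - \<alpha>) * card (set (take m es) \<inter> crossing ?V S)
          \<le> 2 * \<alpha> * card (set (take m es) \<inter> all_edges S)"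
      show False
      proof (cases "3000 * card S \<le> n")
        case True
        \<comment> \<open>Moving on to \<open>m2\<close> only adds inner edges, moving back to
          \<open>m1\<close> only removes crossing edges; this replaces a union over the time
          \<open>m\<close>.\<close>
        have A: "card (set (take m es) \<inter> all_edges S) \<le> card (set (take m2 es) \<inter> all_edges S)"
          using set_take_subset_set_take[OF m12(2), of es] by (intro card_mono) auto
        have B: "card (set (take m1 es) \<inter> crossing ?V S) \<le> card (set (take m es) \<inter> crossing ?V S)"
          using set_take_subset_set_take[OF m12(1), of es] by (intro card_mono) auto
        \<comment> \<open>Since \<alpha> is below 1/2, \<open>1 - \<alpha>\<close> is at least 1/2
          and \<open>2 * \<alpha>\<close> at most 1: this is the factor \<open>2\<close> in
          \<open>small\<close>.\<close>
        have "1 / 2 * real (card (set (take m es) \<inter> crossing ?V S))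
            \<le> (1 - \<alpha>) * card (set (take m es) \<inter> crossing ?V S)"
          using \<delta> by (intro mult_right_mono) (auto simp: \<alpha>_def)
        also note cut
        also have "2 * \<alpha> * card (set (take m es) \<inter> all_edges S) \<le> 1 * real (card (set (take m es) \<inter> all_edges S))"
          using \<delta> by (intro mult_right_mono) (auto simp: \<alpha>_def)
        finally have "card (set (take m es) \<inter> crossing ?V S) \<le> 2 * card (set (take m es) \<inter> all_edges S)"
          by linarith
        with A B heavy have "card S \<le> 2 * card (set (take m2 es) \<inter> all_edges S)"
          "card (set (take m1 es) \<inter> crossing ?V S) \<le> 2 * card (set (take m2 es) \<inter> all_edges S)"
          by linarith+
        moreover have "take m1 (take m2 es) = take m1 es" using m by (simp add: min_def)
        ultimately have "es \<in> E3"
          unfolding E3_def small_def mem_Collect_eq using S True by (intro bexI[of _ S]) (auto simp: F1_def)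
        then show False using nE by blast
      next
        case False
        then have "(m, S) \<in> {m1..m2} \<times> F2" using S m12 by (simp add: F2_def)
        then have "es \<in> E4" unfolding E4_def using cut by blast
        then show False using nE by blast
      qed
    qed (use n \<delta> in \<open>auto simp: \<alpha>_def\<close>)
  qed
  have "1 - measure_pmf.prob ?p {es. good es} = measure_pmf.prob ?p (UNIV - {es. good es})"
    using measure_pmf.prob_compl[of "{es. good es}" ?p] by simp
  also have "\<dots> \<le> measure_pmf.prob ?p (E1 \<union> E2 \<union> E3 \<union> E4)"
    using good by (intro measure_pmf.finite_measure_mono_AE) (auto simp: AE_measure_pmf_iff)
  also have "\<dots> \<le> measure_pmf.prob ?p E1 + measure_pmf.prob ?p E2 + measure_pmf.prob ?p E3 + measure_pmf.prob ?p E4"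
    by (intro order_trans[OF measure_Un_le] add_mono) auto
  finally have "1 - measure_pmf.prob ?p {es. good es} \<le> n * exp (- (2 * real m2 / n))
      + 1 / (n * (1 - (real n - 1) / (real N - m1)) ^ m1) + 2 * r
      + (real m2 + 1) * 2 ^ n * exp (- (\<delta>\<^sup>2 / 20000 * n * ln n))"
    using P1 P2 P3 P4 by linarith
  moreover have "measure_pmf.prob (random_graph_process n)
      {Gs. resilient (1 / 2 - \<epsilon>) connected_graph (Gs ! tau1 Gs)} = measure_pmf.prob ?p {es. good es}"
    unfolding random_graph_process_def graph_process_upto_draws good_def N by simp
  ultimately show ?thesis by linarith
qed

theorem theorem1p3:
  fixes \<epsilon> :: real
  assumes "\<epsilon> > 0"
  shows "(\<lambda>n. measure_pmf.prob (random_graph_process n)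
            {Gs. resilient (1/2 - \<epsilon>) connected_graph (Gs ! tau1 Gs)}) \<longlonglongrightarrow> 1"
proof -
  \<comment> \<open>The Chernoff bound wants \<open>\<delta> \<le> 1 / 4\<close>. A larger
    \<epsilon> permits fewer deletions and is covered by the smaller \<delta>.\<close>
  define \<delta> where "\<delta> = min \<epsilon> (1 / 4)"
  have \<delta>: "0 < \<delta>" "\<delta> \<le> 1 / 4" "\<delta> \<le> \<epsilon>" using assms by (auto simp: \<delta>_def)
  define c where "c = \<delta>\<^sup>2 / 20000"
  have c: "c > 0" using \<delta> by (simp add: c_def)
  \<comment> \<open>With 2/5 about n^(1/5) isolated vertices are expected at \<open>m1\<close>,
    still unboundedly many, while \<open>m1 / N\<close> is about 0.8 ln n / n, above the required
    0.78 ln n / n.\<close>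
  define M :: "real \<Rightarrow> real" where "M x = 2 / 5 * (x * ln x)" for x
  define r :: "real \<Rightarrow> real" where "r x = 2 * sqrt (3000 * x) * exp (- (65 / 100 * ln x))" for x
  \<comment> \<open>A majorant of the four error terms in a real variable: natural powers become
    \<open>powr\<close>, and rounding turns \<open>real m2 + 1\<close> into
    \<open>x * ln x + 2\<close>.\<close>
  define h :: "real \<Rightarrow> real" where "h x = x * exp (- (2 * ln x))
    + 1 / (x * (1 - (x - 1) / (x * (x - 1) / 2 - M x)) powr M x) + 2 * r x
    + (x * ln x + 2) * 2 powr x * exp (- (c * x * ln x))" for x
  have h0: "((\<lambda>n. 1 - h (real n)) \<longlongrightarrow> 1) sequentially"
  proof -
    have "((\<lambda>x::real. x * exp (- (2 * ln x))) \<longlongrightarrow> 0) at_top" by real_asymp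
    moreover have "((\<lambda>x::real. 1 / (x * (1 - (x - 1) / (x * (x - 1) / 2 - M x)) powr M x)) \<longlongrightarrow> 0) at_top"
      unfolding M_def by real_asymp
    moreover have "((\<lambda>x::real. 2 * r x) \<longlongrightarrow> 0) at_top"
      unfolding r_def by real_asymp
    \<comment> \<open>However small \<open>c\<close> is, \<open>c * x * ln x\<close> eventually
      dominates \<open>x * ln 2\<close>.\<close>
    moreover have "((\<lambda>x::real. (x * ln x + 2) * 2 powr x * exp (- (c * x * ln x))) \<longlongrightarrow> 0) at_top"
      using c by real_asymp
    ultimately have "((\<lambda>x. 1 - h x) \<longlongrightarrow> 1 - (0 + 0 + 0 + 0)) at_top"
      unfolding h_def by (intro tendsto_intros)
    then have "((\<lambda>x. 1 - h x) \<longlongrightarrow> 1) at_top" by simp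
    then show ?thesis by (rule filterlim_compose[OF _ filterlim_real_sequentially])
  qed
  \<comment> \<open>In units of \<open>ln x / x\<close> the two density conditions become 0.78 < 0.8
    and 0.8 + 2 < 3 in the limit.\<close>
  have ev: "\<forall>\<^sub>F x::real in at_top. x \<ge> 2 \<and> x * ln x + 1 \<le> x * (x - 1) / 2 \<and> M x + 2 * x \<le> x * (x - 1) / 2
      \<and> 78 / 100 * (ln x / x) \<le> (M x - 1) / (x * (x - 1) / 2)
      \<and> M x / (x * (x - 1) / 2) + (x * ln x + 1) / (x * (x - 1) / 2 - M x) \<le> 3 * (ln x / x)
      \<and> r x \<le> 1 / 2 \<and> 0 \<le> M x \<and> 1 \<le> M x"
    unfolding M_def r_def by (intro eventually_conj; real_asymp)
  have "\<forall>\<^sub>F n in sequentially. 1 - h (real n) \<le> measure_pmf.prob (random_graph_process n)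
      {Gs. resilient (1 / 2 - \<epsilon>) connected_graph (Gs ! tau1 Gs)}"
    using filterlim_real_sequentially[unfolded filterlim_iff, rule_format, OF ev]
  proof eventually_elim
    case (elim n)
    define x where "x = real n"
    note x = elim[folded x_def]
    \<comment> \<open>Rounding \<open>m1\<close> down and \<open>m2\<close> up goes in the direction
      that improves the isolated-vertex bounds.\<close>
    define m1 where "m1 = nat \<lfloor>M x\<rfloor>"
    define m2 where "m2 = nat \<lceil>x * ln x\<rceil>"
    define N where "N = n choose 2"
    have realN: "real N = x * (x - 1) / 2"
      using real_card_all_edges[of "{..<n}"] by (simp add: N_def x_def card_all_edges)
    have xlx: "0 \<le> x * ln x" "M x \<le> x * ln x" using x by (auto simp: M_def)
    have m1: "real m1 \<le> M x" "M x - 1 \<le> real m1" using x unfolding m1_def by linarith+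
    have m2: "x * ln x \<le> real m2" "real m2 \<le> x * ln x + 1" using xlx unfolding m2_def by linarith+
    have N0: "real N - M x > 0" using x realN by linarith
    have "1 - (n * exp (- (2 * real m2 / n)) + 1 / (n * (1 - (real n - 1) / (real N - m1)) ^ m1) + 2 * r x
        + (real m2 + 1) * 2 ^ n * exp (- (\<delta>\<^sup>2 / 20000 * n * ln n)))
      \<le> measure_pmf.prob (random_graph_process n) {Gs. resilient (1 / 2 - \<epsilon>) connected_graph (Gs ! tau1 Gs)}"
    proof (rule prob_process_resilient_ge[OF _ N_def _ _ _ \<delta> refl])
      show "2 \<le> n" using x by (simp add: x_def)
      show "m1 \<le> m2" using m1 m2 xlx by linarith
      show "m2 \<le> N" using m2 x realN by linarith
      show "m1 + 2 * n \<le> N" using m1 x realN unfolding x_def by linarith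
      have "(M x - 1) / real N \<le> m1 / real N" using m1 by (intro divide_right_mono) auto
      then show "78 / 100 * (ln n / n) \<le> m1 / N" using x[folded realN] unfolding x_def by linarith
      have "m1 / N + (real m2 - m1) / (real N - m1) \<le> M x / N + (x * ln x + 1) / (real N - M x)"
        using m1 m2 xlx N0 x by (intro add_mono divide_right_mono frac_le) auto
      then show "m1 / N + (real m2 - m1) / (real N - m1) \<le> 3 * (ln n / n)"
        using x[folded realN] unfolding x_def by linarith
      show "r x = 2 * sqrt (3000 * real n) * exp (- (65 / 100 * ln n))" by (simp add: r_def x_def)
      show "r x \<le> 1 / 2" using x by simp
    qed
    moreover have "n * exp (- (2 * real m2 / n)) \<le> x * exp (- (2 * ln x))"
    proof -
      have "2 * ln x \<le> 2 * real m2 / x" using m2 x by (simp add: field_simps)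
      then show ?thesis by (simp flip: x_def) (use x in simp)
    qed
    moreover have "1 / (n * (1 - (real n - 1) / (real N - m1)) ^ m1)
        \<le> 1 / (x * (1 - (x - 1) / (x * (x - 1) / 2 - M x)) powr M x)"
    proof -
      define y where "y = 1 - (x - 1) / (real N - M x)"
      have y: "0 < y" "y \<le> 1" using x realN N0 by (auto simp: y_def field_simps)
      \<comment> \<open>The base lies in (0, 1], so lowering the exponent from \<open>M x\<close> to
        \<open>m1\<close> increases the power.\<close>
      have "y powr M x \<le> y powr m1" using y m1 by (intro powr_mono') auto
      also have "\<dots> = y ^ m1" using y by (simp add: powr_realpow)
      also have "\<dots> \<le> (1 - (x - 1) / (real N - m1)) ^ m1"
        unfolding y_def using y N0 m1 x
        by (intro power_mono diff_left_mono divide_left_mono mult_pos_pos) (auto simp: y_def)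
      finally have "x * y powr M x \<le> x * (1 - (x - 1) / (real N - m1)) ^ m1"
        using x by (intro mult_left_mono) auto
      moreover have "0 < x * y powr M x" using x y by simp
      ultimately have "1 / (x * (1 - (x - 1) / (real N - m1)) ^ m1) \<le> 1 / (x * y powr M x)"
        by (intro frac_le) auto
      then show ?thesis by (simp add: y_def x_def realN)
    qed
    moreover have "(real m2 + 1) * 2 ^ n * exp (- (\<delta>\<^sup>2 / 20000 * n * ln n))
        \<le> (x * ln x + 2) * 2 powr x * exp (- (c * x * ln x))"
      using m2 by (simp add: x_def c_def powr_realpow)
    ultimately show ?case unfolding h_def x_def by linarith
  qed
  then show ?thesis
    by (intro tendsto_sandwich[OF _ _ h0 tendsto_const]) auto
qed

end
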